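(* Let $S$ be a connected smooth manifold, let $\omega$ be a nowhere vanishing smooth one-form on $S$, and let $x\in S$ be such that $I^+_\omega(x)\neq S$. Then the boundary $\Sigma:=\partial I^+_\omega(x)$ is a (non-empty) smooth hypersurface which separates $S$ (i.e. $S\setminus\Sigma$ is disconnected).
   Context: $S$ has dimension at least $2$. Let $\mathcal A:=\{v\in TS:\ -\omega(v)>0\}$. An absolutely continuous curve $\gamma:I\to S$ is called admissible if $\dot\gamma(t)\in\mathcal A$ for almost all $t\in I$. $I^+_\omega(x)$ is the set of terminal points of admissible curves starting at $x$. *)

theory Defs
  imports "HOL-Analysis.Analysis"
begin

section \<open>Smooth maps between Euclidean spaces\<close>

text \<open>Intended for open \<open>S\<close>. Order \<open>n\<close> means that all iterated directional derivatives up to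
  order \<open>n\<close> exist and are continuous, that is, \<open>f\<close> is of class \<open>C\<close>-\<open>n\<close> on \<open>S\<close>.\<close>

primrec cont_diff_on :: "nat \<Rightarrow> ('e::euclidean_space \<Rightarrow> 'f::euclidean_space) \<Rightarrow> 'e set \<Rightarrow> bool" where
  "cont_diff_on 0 f S \<longleftrightarrow> continuous_on S f"
| "cont_diff_on (Suc n) f S \<longleftrightarrow> (\<forall>x\<in>S. f differentiable (at x)) \<and>
     (\<forall>v. cont_diff_on n (\<lambda>x. frechet_derivative f (at x) v) S)"

definition smooth_on :: "('e::euclidean_space \<Rightarrow> 'f::euclidean_space) \<Rightarrow> 'e set \<Rightarrow> bool" where
  "smooth_on f S \<longleftrightarrow> (\<forall>n. cont_diff_on n f S)"


section \<open>Smooth manifolds\<close>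

text \<open>A manifold is a Hausdorff, second countable type \<open>'a\<close> together with a maximal smooth atlas of
  charts with values in \<open>'e\<close>; its dimension is \<open>DIM('e)\<close>. A chart is a pair \<open>(U, \<phi>)\<close>; the values of
  \<open>\<phi>\<close> outside \<open>U\<close> carry no meaning.\<close>

type_synonym ('a, 'e) chart = "'a set \<times> ('a \<Rightarrow> 'e)"

definition is_chart ::
    "('a::{t2_space,second_countable_topology}, 'e::euclidean_space) chart \<Rightarrow> bool" where
  "is_chart c \<longleftrightarrow> open (fst c) \<and> open (snd c ` fst c) \<and>
     (\<exists>\<psi>. homeomorphism (fst c) (snd c ` fst c) (snd c) \<psi>)"

definition chart_inv :: "('a, 'e) chart \<Rightarrow> 'e \<Rightarrow> 'a" where
  "chart_inv c = inv_into (fst c) (snd c)"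

definition transition :: "('a, 'e) chart \<Rightarrow> ('a, 'e) chart \<Rightarrow> 'e \<Rightarrow> 'e" where
  "transition c d = snd d \<circ> chart_inv c"

definition smoothly_compatible ::
    "('a, 'e::euclidean_space) chart \<Rightarrow> ('a, 'e) chart \<Rightarrow> bool" where
  "smoothly_compatible c d \<longleftrightarrow>
     smooth_on (transition c d) (snd c ` (fst c \<inter> fst d)) \<and>
     smooth_on (transition d c) (snd d ` (fst c \<inter> fst d))"

definition smooth_structure ::
    "('a::{t2_space,second_countable_topology}, 'e::euclidean_space) chart set \<Rightarrow> bool" where
  "smooth_structure A \<longleftrightarrow>
     (\<forall>c\<in>A. is_chart c) \<and>
     (\<Union>c\<in>A. fst c) = UNIV \<and>
     (\<forall>c\<in>A. \<forall>d\<in>A. smoothly_compatible c d) \<and>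
     (\<forall>c. is_chart c \<and> (\<forall>d\<in>A. smoothly_compatible c d) \<longrightarrow> c \<in> A)"

definition charts_at :: "('a, 'e) chart set \<Rightarrow> 'a \<Rightarrow> ('a, 'e) chart set" where
  "charts_at A p = {c\<in>A. p \<in> fst c}"


section \<open>Tangent vectors and one-forms\<close>

text \<open>A tangent vector at \<open>p\<close> is the family of its coordinate expressions in all charts around \<open>p\<close>,
  related by the differentials of the transition maps. The value \<open>0\<close> at the other charts makes
  this representation unique.\<close>

type_synonym ('a, 'e) tangent_vector = "('a, 'e) chart \<Rightarrow> 'e"

definition tangent_space ::
    "('a, 'e::euclidean_space) chart set \<Rightarrow> 'a \<Rightarrow> ('a, 'e) tangent_vector set" where
  "tangent_space A p = {v.
     (\<forall>c\<in>charts_at A p. \<forall>d\<in>charts_at A p.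
        v d = frechet_derivative (transition c d) (at (snd c p)) (v c)) \<and>
     (\<forall>c. c \<notin> charts_at A p \<longrightarrow> v c = 0)}"

definition tangent_bundle ::
    "('a, 'e::euclidean_space) chart set \<Rightarrow> ('a \<times> ('a, 'e) tangent_vector) set" where
  "tangent_bundle A = Sigma UNIV (tangent_space A)"

text \<open>The tangent vector at \<open>p\<close> whose coordinate expression in the chart \<open>c\<close> is \<open>e\<close>; as \<open>p\<close> varies,
  the vector field on the domain of \<open>c\<close> with constant components \<open>e\<close>.\<close>

definition coord_vector ::
    "('a, 'e::euclidean_space) chart set \<Rightarrow> ('a, 'e) chart \<Rightarrow> 'e \<Rightarrow> 'a \<Rightarrow> ('a, 'e) tangent_vector" where
  "coord_vector A c e p = (\<lambda>d. if d \<in> charts_at A p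
     then frechet_derivative (transition c d) (at (snd c p)) e else 0)"

definition smooth_one_form ::
    "('a, 'e::euclidean_space) chart set \<Rightarrow> ('a \<Rightarrow> ('a, 'e) tangent_vector \<Rightarrow> real) \<Rightarrow> bool" where
  "smooth_one_form A \<omega> \<longleftrightarrow>
     (\<forall>p. \<forall>v\<in>tangent_space A p. \<forall>w\<in>tangent_space A p. \<forall>s t.
        \<omega> p (\<lambda>c. s *\<^sub>R v c + t *\<^sub>R w c) = s * \<omega> p v + t * \<omega> p w) \<and>
     (\<forall>c\<in>A. \<forall>e. smooth_on (\<lambda>y. \<omega> (chart_inv c y) (coord_vector A c e (chart_inv c y)))
        (snd c ` fst c))"

definition nowhere_vanishing ::
    "('a, 'e::euclidean_space) chart set \<Rightarrow> ('a \<Rightarrow> ('a, 'e) tangent_vector \<Rightarrow> real) \<Rightarrow> bool" where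
  "nowhere_vanishing A \<omega> \<longleftrightarrow> (\<forall>p. \<exists>v\<in>tangent_space A p. \<omega> p v \<noteq> 0)"


section \<open>Admissible curves\<close>

text \<open>For \<open>D division_of T\<close> the members of \<open>D\<close> are compact intervals without common interior points,
  so \<open>D\<close> is a finite family of non-overlapping subintervals of \<open>{a..b}\<close>.\<close>

definition abs_continuous_on :: "real \<Rightarrow> real \<Rightarrow> (real \<Rightarrow> 'e::euclidean_space) \<Rightarrow> bool" where
  "abs_continuous_on a b f \<longleftrightarrow>
     (\<forall>\<epsilon>>0. \<exists>\<delta>>0. \<forall>D T. D division_of T \<and> T \<subseteq> {a..b} \<and> (\<Sum>K\<in>D. Sup K - Inf K) < \<delta> \<longrightarrow>
        (\<Sum>K\<in>D. norm (f (Sup K) - f (Inf K))) < \<epsilon>)"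

definition abs_continuous_curve ::
    "('a::topological_space, 'e::euclidean_space) chart set \<Rightarrow> real \<Rightarrow> real \<Rightarrow> (real \<Rightarrow> 'a) \<Rightarrow> bool" where
  "abs_continuous_curve A a b \<gamma> \<longleftrightarrow> continuous_on {a..b} \<gamma> \<and>
     (\<forall>c\<in>A. \<forall>s t. {s..t} \<subseteq> {a..b} \<and> \<gamma> ` {s..t} \<subseteq> fst c \<longrightarrow> abs_continuous_on s t (snd c \<circ> \<gamma>))"

definition has_velocity ::
    "('a, 'e::euclidean_space) chart set \<Rightarrow> (real \<Rightarrow> 'a) \<Rightarrow> ('a, 'e) tangent_vector \<Rightarrow> real \<Rightarrow> real set \<Rightarrow> bool" where
  "has_velocity A \<gamma> v t I \<longleftrightarrow> v \<in> tangent_space A (\<gamma> t) \<and>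
     (\<forall>c\<in>charts_at A (\<gamma> t). ((snd c \<circ> \<gamma>) has_vector_derivative v c) (at t within I))"

definition open_half_bundle ::
    "('a, 'e::euclidean_space) chart set \<Rightarrow> ('a \<Rightarrow> ('a, 'e) tangent_vector \<Rightarrow> real) \<Rightarrow>
     ('a \<times> ('a, 'e) tangent_vector) set" where
  "open_half_bundle A \<omega> = {(p, v) \<in> tangent_bundle A. - \<omega> p v > 0}"

definition admissible ::
    "('a::topological_space, 'e::euclidean_space) chart set \<Rightarrow> ('a \<Rightarrow> ('a, 'e) tangent_vector \<Rightarrow> real) \<Rightarrow>
     real \<Rightarrow> real \<Rightarrow> (real \<Rightarrow> 'a) \<Rightarrow> bool" where
  "admissible A \<omega> a b \<gamma> \<longleftrightarrow> abs_continuous_curve A a b \<gamma> \<and>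
     (AE t in lebesgue. t \<in> {a..b} \<longrightarrow>
        (\<exists>v. has_velocity A \<gamma> v t {a..b} \<and> (\<gamma> t, v) \<in> open_half_bundle A \<omega>))"

text \<open>Curves are parametrised by non-degenerate compact intervals, so the constant curve at \<open>x\<close>,
  for which admissibility would be vacuous, is excluded.\<close>

definition I_plus ::
    "('a::topological_space, 'e::euclidean_space) chart set \<Rightarrow> ('a \<Rightarrow> ('a, 'e) tangent_vector \<Rightarrow> real) \<Rightarrow>
     'a \<Rightarrow> 'a set" where
  "I_plus A \<omega> x = {y. \<exists>a b \<gamma>. a < b \<and> admissible A \<omega> a b \<gamma> \<and> \<gamma> a = x \<and> \<gamma> b = y}"


section \<open>Hypersurfaces\<close>

text \<open>Embedded submanifolds of codimension one, described by slice charts of the maximal atlas.\<close>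

definition smooth_hypersurface :: "('a, 'e::euclidean_space) chart set \<Rightarrow> 'a set \<Rightarrow> bool" where
  "smooth_hypersurface A \<Sigma> \<longleftrightarrow>
     (\<forall>p\<in>\<Sigma>. \<exists>c\<in>charts_at A p. \<exists>b\<in>Basis. \<exists>r.
        snd c ` (\<Sigma> \<inter> fst c) = {y \<in> snd c ` fst c. y \<bullet> b = r})"

definition separates_space :: "'a::topological_space set \<Rightarrow> bool" where
  "separates_space \<Sigma> \<longleftrightarrow> \<not> connected (UNIV - \<Sigma>)"

end

theory Submission
  imports Defs
begin

text \<open>
  Let \<open>I\<close> be the set of points reachable from \<open>x\<close>. An admissible curve may be prolonged by a straight
  segment, in a chart, on which \<open>\<omega>\<close> is negative; as the condition on the segment is open, such a
  segment leads from the closure of \<open>I\<close> into the interior of \<open>I\<close>. Hence near a boundary point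
  the boundary is a graph \<open>y\<^sub>b = f\<close> over a coordinate hyperplane transversal to \<open>ker \<omega>\<close>, with
  interior points on one side and points outside the closure on the other. The chord between two
  boundary points is annihilated by \<open>\<omega>\<close> at one of its points, since otherwise it, or its reverse,
  would lead from the boundary to the interior. So \<open>f\<close> is Lipschitz, then differentiable with
  \<open>df\<close> a smooth function of the graph point, and therefore smooth by bootstrapping.
  Only the interior and the closure of \<open>I\<close> enter, so that the openness of \<open>I\<close> plays no role.
\<close>

section \<open>Calculus of smooth maps\<close>

text \<open>On an open set, functions that agree have the same germ at each point, and so the same
  derivatives. Openness matters because \<open>frechet_derivative\<close> is taken in the whole
  space, not within \<open>S\<close>.\<close>

lemma cont_diff_on_cong:
  assumes "open S" "\<And>x. x \<in> S \<Longrightarrow> f x = g x" "cont_diff_on n f S"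
  shows "cont_diff_on n g S"
  using assms(2,3)
proof (induction n arbitrary: f g)
  case 0
  then show ?case using continuous_on_cong by force
next
  case (Suc n)
  have D: "(g has_derivative frechet_derivative f (at x)) (at x)" if "x \<in> S" for x
    using Suc.prems that frechet_derivative_works
    by (intro has_derivative_transform_within_open[of f _ x UNIV S g] \<open>open S\<close>) auto
  then have "frechet_derivative f (at x) = frechet_derivative g (at x)" if "x \<in> S" for x
    using that frechet_derivative_at by blast
  moreover have "g differentiable at x" if "x \<in> S" for x
    using D[OF that] by (auto simp: differentiable_def)
  ultimately show ?case
    using Suc.prems(2) Suc.IH[of "\<lambda>x. frechet_derivative f (at x) _" "\<lambda>x. frechet_derivative g (at x) _"]
    by simp
qed

text \<open>Derivatives at a point are unique, so any explicitly known derivative can stand for the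
  one selected by \<open>frechet_derivative\<close>. This is the introduction rule behind the
  inductions below.\<close>

lemma cont_diff_on_SucI:
  assumes "open S" "\<And>x. x \<in> S \<Longrightarrow> (f has_derivative f' x) (at x)"
    and "\<And>v. cont_diff_on n (\<lambda>x. f' x v) S"
  shows "cont_diff_on (Suc n) f S"
proof -
  have "f' x = frechet_derivative f (at x)" if "x \<in> S" for x
    using assms(2)[OF that] frechet_derivative_at by blast
  then have "cont_diff_on n (\<lambda>x. frechet_derivative f (at x) v) S" for v
    by (intro cont_diff_on_cong[OF \<open>open S\<close> _ assms(3)[of v]]) auto
  then show ?thesis
    using assms(2) by (auto simp: differentiable_def)
qed

lemma cont_diff_on_SucD: "cont_diff_on (Suc n) f S \<Longrightarrow> cont_diff_on n f S"
proof (induction n arbitrary: f)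
  case 0
  then show ?case
    by (auto intro!: continuous_at_imp_continuous_on differentiable_imp_continuous_within)
next
  case (Suc n)
  from Suc.prems have "\<forall>x\<in>S. f differentiable at x"
    and "\<And>v. cont_diff_on (Suc n) (\<lambda>x. frechet_derivative f (at x) v) S"
    using cont_diff_on.simps(2) by blast+
  then show ?case
    using Suc.IH by simp
qed

lemma cont_diff_on_has_derivative:
  "cont_diff_on (Suc n) f S \<Longrightarrow> x \<in> S \<Longrightarrow> (f has_derivative frechet_derivative f (at x)) (at x)"
  by (auto simp: frechet_derivative_works)

lemma cont_diff_on_subset: "cont_diff_on n f S \<Longrightarrow> T \<subseteq> S \<Longrightarrow> cont_diff_on n f T"
  by (induction n arbitrary: f) (auto intro: continuous_on_subset)

lemma cont_diff_on_const:
  assumes "open S"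
  shows "cont_diff_on n (\<lambda>_. c) S"
proof (induction n arbitrary: c)
  case (Suc n)
  show ?case by (rule cont_diff_on_SucI[OF assms, where f' = "\<lambda>_ _. 0"]) (auto intro: Suc)
qed auto

lemma cont_diff_on_bounded_linear:
  assumes "open S" "bounded_linear L" "cont_diff_on n f S"
  shows "cont_diff_on n (\<lambda>x. L (f x)) S"
  using assms(3)
proof (induction n arbitrary: f)
  case 0
  then show ?case using bounded_linear.continuous_on[OF assms(2)] by auto
next
  case (Suc n)
  show ?case
    by (rule cont_diff_on_SucI[OF \<open>open S\<close>
          bounded_linear.has_derivative[OF assms(2) cont_diff_on_has_derivative[OF Suc.prems]]])
      (use Suc in auto)
qed

lemma cont_diff_on_id:
  assumes "open S"
  shows "cont_diff_on n (\<lambda>x. x) S"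
proof (cases n)
  case (Suc m)
  show ?thesis unfolding Suc
    by (rule cont_diff_on_SucI[OF assms, where f' = "\<lambda>_ h. h"])
      (auto intro: cont_diff_on_const[OF assms])
qed auto

lemma cont_diff_on_add:
  assumes "open S" "cont_diff_on n f S" "cont_diff_on n g S"
  shows "cont_diff_on n (\<lambda>x. f x + g x) S"
  using assms(2,3)
proof (induction n arbitrary: f g)
  case 0
  then show ?case by (auto intro: continuous_intros)
next
  case (Suc n)
  show ?case
    by (rule cont_diff_on_SucI[OF \<open>open S\<close> has_derivative_add[OF
          cont_diff_on_has_derivative[OF Suc.prems(1)] cont_diff_on_has_derivative[OF Suc.prems(2)]]])
      (use Suc in auto)
qed

lemma cont_diff_on_sum:
  assumes "open S" "\<And>i. i \<in> I \<Longrightarrow> cont_diff_on n (f i) S"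
  shows "cont_diff_on n (\<lambda>x. \<Sum>i\<in>I. f i x) S"
  using assms(2)
  by (induction I rule: infinite_finite_induct)
    (auto intro: cont_diff_on_const cont_diff_on_add \<open>open S\<close>)

text \<open>Product rule and induction. In the derivative each factor also occurs undifferentiated,
  and \<open>cont_diff_on_SucD\<close> supplies it at the lower order.\<close>

lemma cont_diff_on_scaleR:
  assumes "open S" "cont_diff_on n f S" "cont_diff_on n g S"
  shows "cont_diff_on n (\<lambda>x. f x *\<^sub>R g x) S"
  using assms(2,3)
proof (induction n arbitrary: f g)
  case 0
  then show ?case by (auto intro: continuous_intros)
next
  case (Suc n)
  show ?case
    by (rule cont_diff_on_SucI[OF \<open>open S\<close> has_derivative_scaleR[OF
          cont_diff_on_has_derivative[OF Suc.prems(1)] cont_diff_on_has_derivative[OF Suc.prems(2)]]])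
      (use Suc.prems Suc.prems[THEN cont_diff_on_SucD] in
        \<open>auto intro!: cont_diff_on_add Suc.IH \<open>open S\<close>\<close>)
qed

text \<open>The derivative of the reciprocal is expressed by the derivative of \<open>f\<close> and
  the reciprocal itself, which is already known to have order \<open>n\<close> by induction.\<close>

lemma cont_diff_on_inverse:
  fixes f :: "'a::euclidean_space \<Rightarrow> real"
  assumes "open S" "cont_diff_on n f S" "\<And>x. x \<in> S \<Longrightarrow> f x \<noteq> 0"
  shows "cont_diff_on n (\<lambda>x. inverse (f x)) S"
  using assms(2)
proof (induction n)
  case 0
  then show ?case using assms(3) by (auto intro: continuous_intros)
next
  case (Suc n)
  have *: "cont_diff_on n (\<lambda>x. inverse (f x)) S"
    using Suc cont_diff_on_SucD by blast
  have **: "cont_diff_on n (\<lambda>x. - (inverse (f x) * (h x * inverse (f x)))) S"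
    if "cont_diff_on n h S" for h
    using cont_diff_on_bounded_linear[OF \<open>open S\<close> bounded_linear_minus[OF bounded_linear_ident]
        cont_diff_on_scaleR[OF \<open>open S\<close> * cont_diff_on_scaleR[OF \<open>open S\<close> that *]]]
    by simp
  show ?case
    by (rule cont_diff_on_SucI[OF \<open>open S\<close> Deriv.has_derivative_inverse[OF assms(3)
          cont_diff_on_has_derivative[OF Suc.prems]]])
      (use Suc.prems ** in \<open>auto simp: mult.assoc\<close>)
qed

lemma cont_diff_on_compose:
  fixes f :: "'a::euclidean_space \<Rightarrow> 'b::euclidean_space" and g :: "'b \<Rightarrow> 'c::euclidean_space"
  assumes "open S" "open T" "f ` S \<subseteq> T" "cont_diff_on n g T" "cont_diff_on n f S"
  shows "cont_diff_on n (\<lambda>x. g (f x)) S"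
  using assms(4,5)
proof (induction n arbitrary: g)
  case 0
  then show ?case using assms(3) by (auto intro: continuous_on_compose2)
next
  case (Suc n)
  let ?g' = "\<lambda>y. frechet_derivative g (at y)" and ?f' = "\<lambda>x. frechet_derivative f (at x)"
  have D: "((\<lambda>x. g (f x)) has_derivative (\<lambda>v. ?g' (f x) (?f' x v))) (at x)" if "x \<in> S" for x
    using has_derivative_compose[OF cont_diff_on_has_derivative[OF Suc.prems(2) that]
        cont_diff_on_has_derivative[OF Suc.prems(1), of "f x"]] that assms(3) by blast
  \<comment> \<open>In the chain rule the derivative of \<open>g\<close> is applied to a vector that
    varies with \<open>x\<close>, while \<open>cont_diff_on\<close> speaks of fixed directions only.
    Expanding that vector in the basis leaves partial derivatives of \<open>g\<close> composed with
    \<open>f\<close>, to which the induction hypothesis applies.\<close>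
  have eq: "?g' (f x) w = (\<Sum>b\<in>Basis. (w \<bullet> b) *\<^sub>R ?g' (f x) b)" if "x \<in> S" for x w
  proof -
    have "linear (?g' (f x))"
      using cont_diff_on_has_derivative[OF Suc.prems(1), of "f x"] that assms(3)
        has_derivative_linear by blast
    then have "?g' (f x) (\<Sum>b\<in>Basis. (w \<bullet> b) *\<^sub>R b) = (\<Sum>b\<in>Basis. (w \<bullet> b) *\<^sub>R ?g' (f x) b)"
      by (simp add: linear_sum linear_scale)
    then show ?thesis by (simp add: euclidean_representation)
  qed
  have "cont_diff_on n (\<lambda>x. \<Sum>b\<in>Basis. (?f' x v \<bullet> b) *\<^sub>R ?g' (f x) b) S" for v
  proof (intro cont_diff_on_sum[OF \<open>open S\<close>] cont_diff_on_scaleR[OF \<open>open S\<close>])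
    fix b :: 'b
    show "cont_diff_on n (\<lambda>x. ?f' x v \<bullet> b) S"
      using Suc.prems(2) by (intro cont_diff_on_bounded_linear[OF \<open>open S\<close> bounded_linear_inner_left]) simp
    show "cont_diff_on n (\<lambda>x. ?g' (f x) b) S"
      using Suc.prems cont_diff_on_SucD[OF Suc.prems(2)] by (intro Suc.IH) auto
  qed
  then have "cont_diff_on n (\<lambda>x. ?g' (f x) (?f' x v)) S" for v
    by (rule cont_diff_on_cong[OF \<open>open S\<close>, rotated]) (use eq in auto)
  then show ?case
    by (intro cont_diff_on_SucI[OF \<open>open S\<close> D]) auto
qed

lemma smooth_on_has_derivative:
  "smooth_on f S \<Longrightarrow> x \<in> S \<Longrightarrow> (f has_derivative frechet_derivative f (at x)) (at x)"
  using cont_diff_on_has_derivative unfolding smooth_on_def by blast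

lemma smooth_on_cong:
  "open S \<Longrightarrow> smooth_on f S \<Longrightarrow> (\<And>x. x \<in> S \<Longrightarrow> f x = g x) \<Longrightarrow> smooth_on g S"
  unfolding smooth_on_def using cont_diff_on_cong by blast

lemma smooth_on_subset: "smooth_on f S \<Longrightarrow> T \<subseteq> S \<Longrightarrow> smooth_on f T"
  unfolding smooth_on_def using cont_diff_on_subset by blast

lemma smooth_on_compose:
  "open S \<Longrightarrow> open T \<Longrightarrow> f ` S \<subseteq> T \<Longrightarrow> smooth_on g T \<Longrightarrow> smooth_on f S \<Longrightarrow> smooth_on (\<lambda>x. g (f x)) S"
  unfolding smooth_on_def using cont_diff_on_compose by blast


section \<open>Absolutely continuous functions\<close>

lemma division_of_Inf_Sup:
  fixes D :: "real set set"
  assumes "D division_of T" "T \<subseteq> {a..b}" "K \<in> D"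
  shows "K = {Inf K..Sup K}" "Inf K \<le> Sup K" "a \<le> Inf K" "Sup K \<le> b"
proof -
  obtain l u where K: "K = {l..u}" "K \<noteq> {}" "K \<subseteq> T"
    using assms(1,3) unfolding division_of_def by force
  then show "K = {Inf K..Sup K}" "Inf K \<le> Sup K" by auto
  then show "a \<le> Inf K" "Sup K \<le> b" using K assms(2) by (auto, force+)
qed

lemma abs_continuous_on_lipschitz:
  assumes "\<And>u v. a \<le> u \<Longrightarrow> u \<le> v \<Longrightarrow> v \<le> b \<Longrightarrow> norm (f v - f u) \<le> L * (v - u)"
  shows "abs_continuous_on a b f"
  unfolding abs_continuous_on_def
proof (intro allI impI)
  fix \<epsilon> :: real assume "\<epsilon> > 0"
  \<comment> \<open>The sign of \<open>L\<close> is not prescribed; \<open>M\<close> is a positive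
    constant above it, by which one can divide.\<close>
  define M where "M = \<bar>L\<bar> + 1"
  have "M > 0" by (simp add: M_def)
  show "\<exists>\<delta>>0. \<forall>D T. D division_of T \<and> T \<subseteq> {a..b} \<and> (\<Sum>K\<in>D. Sup K - Inf K) < \<delta> \<longrightarrow>
        (\<Sum>K\<in>D. norm (f (Sup K) - f (Inf K))) < \<epsilon>"
  proof (intro exI[of _ "\<epsilon> / M"] conjI allI impI; (elim conjE)?)
    fix D T assume DT: "D division_of T" "T \<subseteq> {a..b}" "(\<Sum>K\<in>D. Sup K - Inf K) < \<epsilon> / M"
    have "norm (f (Sup K) - f (Inf K)) \<le> M * (Sup K - Inf K)" if "K \<in> D" for K
    proof -
      note * = division_of_Inf_Sup[OF DT(1,2) that]
      have "norm (f (Sup K) - f (Inf K)) \<le> L * (Sup K - Inf K)" using * by (intro assms) auto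
      also have "\<dots> \<le> M * (Sup K - Inf K)" using * by (intro mult_right_mono) (auto simp: M_def)
      finally show ?thesis .
    qed
    then have "(\<Sum>K\<in>D. norm (f (Sup K) - f (Inf K))) \<le> M * (\<Sum>K\<in>D. Sup K - Inf K)"
      by (simp add: sum_distrib_left sum_mono)
    also have "\<dots> < \<epsilon>" using DT(3) \<open>M > 0\<close> by (simp add: field_simps)
    finally show "(\<Sum>K\<in>D. norm (f (Sup K) - f (Inf K))) < \<epsilon>" .
  qed (use \<open>\<epsilon> > 0\<close> \<open>M > 0\<close> in auto)
qed

lemma abs_continuous_on_cong:
  assumes "\<And>t. t \<in> {a..b} \<Longrightarrow> f t = g t" "abs_continuous_on a b f"
  shows "abs_continuous_on a b g"
proof -
  have "(\<Sum>K\<in>D. norm (f (Sup K) - f (Inf K))) = (\<Sum>K\<in>D. norm (g (Sup K) - g (Inf K)))"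
    if "D division_of T" "T \<subseteq> {a..b}" for D T
  proof (rule sum.cong[OF refl])
    fix K assume "K \<in> D"
    note division_of_Inf_Sup[OF that this]
    then show "norm (f (Sup K) - f (Inf K)) = norm (g (Sup K) - g (Inf K))"
      by (auto simp: assms(1))
  qed
  then show ?thesis using assms(2) unfolding abs_continuous_on_def by metis
qed

text \<open>Distinct members of \<open>D\<close> may have the same trace on \<open>{a..b}\<close>.
  As their interiors are disjoint, such a trace is a single point and contributes zero, so summing
  over the set of traces equals summing over the members that meet \<open>{a..b}\<close>.\<close>

lemma division_of_Int_interval:
  fixes D :: "real set set" and f :: "real \<Rightarrow> 'e::real_normed_vector" and a b :: real
  assumes "D division_of T"
  defines "D' \<equiv> (\<lambda>K. K \<inter> {a..b}) ` {K \<in> D. K \<inter> {a..b} \<noteq> {}}"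
  shows "D' division_of (T \<inter> {a..b})"
    and "(\<Sum>K\<in>D'. norm (f (Sup K) - f (Inf K))) =
         (\<Sum>K | K \<in> D \<and> K \<inter> {a..b} \<noteq> {}. norm (f (Sup (K \<inter> {a..b})) - f (Inf (K \<inter> {a..b}))))"
proof -
  note D = division_ofD[OF assms(1)]
  have iv: "\<exists>l u. K \<inter> {a..b} = {l..u} \<and> l \<le> u" if K: "K \<in> D" "K \<inter> {a..b} \<noteq> {}" for K
  proof -
    obtain l u where "K = {l..u}" using D(4)[OF K(1)] by (metis box_real(2))
    then show ?thesis using K(2) by (intro exI[of _ "max l a"] exI[of _ "min u b"]) auto
  qed
  have int: "interior (K \<inter> {a..b}) \<inter> interior (K' \<inter> {a..b}) = {}" if "K \<in> D" "K' \<in> D" "K \<noteq> K'" for K K'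
    using D(5)[OF that] by auto
  show "D' division_of (T \<inter> {a..b})"
    unfolding D'_def
  proof (rule division_ofI)
    show "\<Union> ((\<lambda>K. K \<inter> {a..b}) ` {K \<in> D. K \<inter> {a..b} \<noteq> {}}) = T \<inter> {a..b}"
      using D(6) by auto
  next
    show "finite ((\<lambda>K. K \<inter> {a..b}) ` {K \<in> D. K \<inter> {a..b} \<noteq> {}})" using D(1) by simp
  next
    fix K assume "K \<in> (\<lambda>K. K \<inter> {a..b}) ` {K \<in> D. K \<inter> {a..b} \<noteq> {}}"
    then obtain K0 where K0: "K0 \<in> D" "K0 \<inter> {a..b} \<noteq> {}" "K = K0 \<inter> {a..b}" by auto
    then show "K \<subseteq> T \<inter> {a..b}" "K \<noteq> {}" using D(2) by auto
    show "\<exists>l u. K = cbox l u" using iv[OF K0(1,2)] K0(3) by (metis box_real(2))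
  next
    fix K K' assume "K \<in> (\<lambda>K. K \<inter> {a..b}) ` {K \<in> D. K \<inter> {a..b} \<noteq> {}}"
      "K' \<in> (\<lambda>K. K \<inter> {a..b}) ` {K \<in> D. K \<inter> {a..b} \<noteq> {}}" "K \<noteq> K'"
    then show "interior K \<inter> interior K' = {}" using int by blast
  qed
  have "f (Sup (K \<inter> {a..b})) = f (Inf (K \<inter> {a..b}))"
    if K: "K \<in> D" "K \<inter> {a..b} \<noteq> {}" "K' \<in> D" "K \<noteq> K'" "K \<inter> {a..b} = K' \<inter> {a..b}" for K K'
  proof -
    obtain l u where lu: "K \<inter> {a..b} = {l..u}" "l \<le> u" using iv K by blast
    then have "interior {l..u} = {}" using int[OF K(1,3,4)] K(5) by auto
    then have "l = u" using lu by (auto simp: interior_atLeastAtMost_real)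
    then show ?thesis using lu by simp
  qed
  then show "(\<Sum>K\<in>D'. norm (f (Sup K) - f (Inf K))) =
      (\<Sum>K | K \<in> D \<and> K \<inter> {a..b} \<noteq> {}. norm (f (Sup (K \<inter> {a..b})) - f (Inf (K \<inter> {a..b}))))"
    unfolding D'_def using D(1) by (subst sum.reindex_nontrivial) auto
qed

text \<open>Cutting every interval of a division at \<open>b\<close> gives one division in each
  half, of no greater total length. By the triangle inequality the variation is at most the sum of
  the variations over the two halves, each below \<open>\<epsilon> / 2\<close>.\<close>

lemma abs_continuous_on_join:
  fixes f :: "real \<Rightarrow> 'e::euclidean_space"
  assumes "abs_continuous_on a b f" "abs_continuous_on b c f" "a \<le> b" "b \<le> c"
  shows "abs_continuous_on a c f"
  unfolding abs_continuous_on_def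
proof (intro allI impI)
  fix \<epsilon> :: real assume "\<epsilon> > 0"
  let ?S = "\<lambda>g D. \<Sum>K\<in>D. norm (g (Sup K) - g (Inf K) :: 'e)"
  let ?L = "\<lambda>D :: real set set. \<Sum>K\<in>D. Sup K - Inf K"
  obtain \<delta>1 where \<delta>1: "\<delta>1 > 0"
    "\<And>D T. D division_of T \<Longrightarrow> T \<subseteq> {a..b} \<Longrightarrow> ?L D < \<delta>1 \<Longrightarrow> ?S f D < \<epsilon> / 2"
    using assms(1) \<open>\<epsilon> > 0\<close> unfolding abs_continuous_on_def by (metis half_gt_zero)
  obtain \<delta>2 where \<delta>2: "\<delta>2 > 0"
    "\<And>D T. D division_of T \<Longrightarrow> T \<subseteq> {b..c} \<Longrightarrow> ?L D < \<delta>2 \<Longrightarrow> ?S f D < \<epsilon> / 2"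
    using assms(2) \<open>\<epsilon> > 0\<close> unfolding abs_continuous_on_def by (metis half_gt_zero)
  have "?S f D < \<epsilon>" if D: "D division_of T" "T \<subseteq> {a..c}" "?L D < min \<delta>1 \<delta>2" for D T
  proof -
    have fin: "finite D" using D by auto
    note K = division_of_Inf_Sup[OF D(1,2)]
    \<comment> \<open>The traces on \<open>{l..u}\<close>; empty ones are discarded since the
      members of a division are nonempty.\<close>
    define R where "R = (\<lambda>l u. (\<lambda>K. K \<inter> {l..u}) ` {K \<in> D. K \<inter> {l..u} \<noteq> {}})"
    have R: "R l u division_of (T \<inter> {l..u})"
      "(\<Sum>K\<in>R l u. norm (g (Sup K) - g (Inf K))) =
         (\<Sum>K | K \<in> D \<and> K \<inter> {l..u} \<noteq> {}. norm (g (Sup (K \<inter> {l..u})) - g (Inf (K \<inter> {l..u}))))"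
      for l u and g :: "real \<Rightarrow> 'g::real_normed_vector"
      unfolding R_def by (rule division_of_Int_interval[OF D(1)])+
    have inter: "K \<inter> {l..u} = {max (Inf K) l..min (Sup K) u}" if "K \<in> D" for K l u
    proof -
      have "K \<inter> {l..u} = {Inf K..Sup K} \<inter> {l..u}" using K(1)[OF that] by simp
      then show ?thesis by auto
    qed
    \<comment> \<open>Lengths are increments of the identity function, so the summation formula
      \<open>R(2)\<close> applies to them too.\<close>
    have len: "?L (R l u) \<le> ?L D" for l u
    proof -
      have "?L (R l u) = (\<Sum>K\<in>R l u. norm (Sup K - Inf K))"
        by (intro sum.cong refl) (use division_of_Inf_Sup(2)[OF R(1) Int_lower2] in auto)
      also have "\<dots> = (\<Sum>K | K \<in> D \<and> K \<inter> {l..u} \<noteq> {}. norm (Sup (K \<inter> {l..u}) - Inf (K \<inter> {l..u})))"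
        using R(2)[of "\<lambda>x. x"] by simp
      also have "\<dots> \<le> (\<Sum>K | K \<in> D \<and> K \<inter> {l..u} \<noteq> {}. Sup K - Inf K)"
      proof (rule sum_mono)
        fix K assume "K \<in> {K \<in> D. K \<inter> {l..u} \<noteq> {}}"
        then have "K \<in> D" "max (Inf K) l \<le> min (Sup K) u"
          using inter[of K l u] by (auto simp del: max.bounded_iff min.bounded_iff)
        then show "norm (Sup (K \<inter> {l..u}) - Inf (K \<inter> {l..u})) \<le> Sup K - Inf K"
          by (simp add: inter)
      qed
      also have "\<dots> \<le> ?L D"
        using fin K(2) by (intro sum_mono2) auto
      finally show ?thesis .
    qed
    have "?S f (R a b) < \<epsilon> / 2" "?S f (R b c) < \<epsilon> / 2"
      using \<delta>1(2)[OF R(1) Int_lower2] \<delta>2(2)[OF R(1) Int_lower2] len[of a b] len[of b c] D(3) by auto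
    moreover have "?S f D \<le> ?S f (R a b) + ?S f (R b c)"
    proof -
      let ?t = "\<lambda>l u K. if K \<inter> {l..u} \<noteq> {} then norm (f (Sup (K \<inter> {l..u})) - f (Inf (K \<inter> {l..u}))) else 0"
      have "norm (f (Sup K) - f (Inf K)) \<le> ?t a b K + ?t b c K" if KD: "K \<in> D" for K
      proof -
        note k = K(2-4)[OF KD]
        consider "Sup K < b" | "b < Inf K" | "Inf K \<le> b" "b \<le> Sup K" by linarith
        then show ?thesis
        proof cases
          case 3
          then show ?thesis
            using k norm_triangle_ineq[of "f (Sup K) - f b" "f b - f (Inf K)"]
            by (simp add: inter[OF KD] max_absorb1 max_absorb2 min_absorb1 min_absorb2)
        qed (use k in \<open>simp_all add: inter[OF KD] max_absorb1 max_absorb2 min_absorb1 min_absorb2\<close>)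
      qed
      then have "?S f D \<le> (\<Sum>K\<in>D. ?t a b K + ?t b c K)" by (rule sum_mono)
      also have "\<dots> = ?S f (R a b) + ?S f (R b c)"
        using fin by (simp add: R(2) sum.distrib flip: sum.inter_filter)
      finally show ?thesis .
    qed
    ultimately show ?thesis by linarith
  qed
  then show "\<exists>\<delta>>0. \<forall>D T. D division_of T \<and> T \<subseteq> {a..c} \<and> ?L D < \<delta> \<longrightarrow> ?S f D < \<epsilon>"
    using \<delta>1(1) \<delta>2(1) by (intro exI[of _ "min \<delta>1 \<delta>2"]) auto
qed


section \<open>A boundary crossed in one direction only is a smooth graph\<close>

text \<open>Between two boundary points neither direction of the chord can be descending throughout, so
  by the intermediate value theorem \<open>\<Omega>\<close> annihilates the chord at some point of it.\<close>

lemma exists_orthogonal_on_chord: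
  fixes \<Omega> :: "'e::euclidean_space \<Rightarrow> 'e"
  assumes cont: "continuous_on W \<Omega>" and seg: "closed_segment q q' \<subseteq> W"
    and step: "\<And>y z. y \<in> E \<Longrightarrow> closed_segment y z \<subseteq> W \<Longrightarrow>
      (\<And>\<xi>. \<xi> \<in> closed_segment y z \<Longrightarrow> \<Omega> \<xi> \<bullet> (z - y) < 0) \<Longrightarrow> z \<in> N"
    and q: "q \<in> E - N" "q' \<in> E - N"
  shows "\<exists>\<xi>\<in>closed_segment q q'. \<Omega> \<xi> \<bullet> (q' - q) = 0"
proof (rule ccontr)
  let ?S = "closed_segment q q'" and ?h = "\<lambda>\<xi>. \<Omega> \<xi> \<bullet> (q' - q)"
  assume none: "\<not> (\<exists>\<xi>\<in>?S. ?h \<xi> = 0)"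
  have "connected (?h ` ?S)"
    by (intro connected_continuous_image continuous_intros continuous_on_subset[OF cont seg]) simp
  then have "0 \<in> ?h ` ?S" if "\<xi> \<in> ?S" "\<xi>' \<in> ?S" "?h \<xi> \<le> 0" "0 \<le> ?h \<xi>'" for \<xi> \<xi>'
    using that by (intro connectedD_interval[of "?h ` ?S" "?h \<xi>" "?h \<xi>'" 0]) auto
  then have "\<not> (?h \<xi> \<le> 0 \<and> 0 \<le> ?h \<xi>')" if "\<xi> \<in> ?S" "\<xi>' \<in> ?S" for \<xi> \<xi>'
    using that none by fastforce
  then consider "\<And>\<xi>. \<xi> \<in> ?S \<Longrightarrow> ?h \<xi> < 0" | "\<And>\<xi>. \<xi> \<in> ?S \<Longrightarrow> ?h \<xi> > 0"
    by (meson linorder_le_less_linear)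
  then show False
  proof cases
    case 1
    then show False using step[of q q'] q seg by blast
  next
    case 2
    have "\<Omega> \<xi> \<bullet> (q - q') < 0" if "\<xi> \<in> closed_segment q' q" for \<xi>
      using 2[of \<xi>] that by (auto simp: closed_segment_commute inner_diff_right)
    then show False using step[of q' q] q seg by (auto simp: closed_segment_commute)
  qed
qed

text \<open>Here \<open>f\<close> is constant along \<open>b\<close>, so that it stands for a function on the hyperplane
  orthogonal to \<open>b\<close>.\<close>

lemma boundary_is_smooth_graph:
  fixes \<Omega> :: "'e::euclidean_space \<Rightarrow> 'e"
  assumes "open W" "open N" "open (W - E)" "E \<subseteq> W" "N \<subseteq> E"
    and smooth: "smooth_on \<Omega> W"
    and p: "p \<in> E - N" and "\<Omega> p \<noteq> 0"
    and step: "\<And>y z. y \<in> E \<Longrightarrow> closed_segment y z \<subseteq> W \<Longrightarrow>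
      (\<And>\<xi>. \<xi> \<in> closed_segment y z \<Longrightarrow> \<Omega> \<xi> \<bullet> (z - y) < 0) \<Longrightarrow> z \<in> N"
  obtains b V Y f where "b \<in> Basis" "open V" "p \<in> V" "V \<subseteq> W" "open Y" "V \<subseteq> Y" "smooth_on f Y"
    and "\<And>y s. y + s *\<^sub>R b \<in> Y \<longleftrightarrow> y \<in> Y" "\<And>y s. f (y + s *\<^sub>R b) = f y"
    and "\<And>y. y \<in> V \<Longrightarrow> y \<in> E - N \<longleftrightarrow> y \<bullet> b = f y"
proof -

  \<comment> \<open>A transversal direction and a box around the point\<close>
  have cont: "continuous_on W \<Omega>" using smooth unfolding smooth_on_def by (metis cont_diff_on.simps(1))
  have "p \<in> W" using p assms(4) by auto
  obtain b where b: "b \<in> Basis" "\<Omega> p \<bullet> b \<noteq> 0"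
    using \<open>\<Omega> p \<noteq> 0\<close> by (meson euclidean_all_zero_iff)
  then have bb[simp]: "b \<bullet> b = 1" "norm b = 1" by (simp_all add: inner_same_Basis)
  \<comment> \<open>The sign for which \<open>k *\<^sub>R b\<close> is a descending direction at
    \<open>p\<close>, hence on a small ball around \<open>p\<close>.\<close>
  define k where "k = - sgn (\<Omega> p \<bullet> b)"
  have k: "k * (\<Omega> p \<bullet> b) < 0" "\<bar>k\<bar> = 1" using b(2) by (auto simp: k_def sgn_if)
  have "open (W \<inter> (\<lambda>q. k * (\<Omega> q \<bullet> b)) -` {..<0})"
    by (intro continuous_open_preimage continuous_intros cont \<open>open W\<close>)
  then obtain r where r: "r > 0" and r_sub: "cball p r \<subseteq> W \<inter> (\<lambda>q. k * (\<Omega> q \<bullet> b)) -` {..<0}"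
    using \<open>p \<in> W\<close> k(1) by (metis (no_types, lifting) IntI lessThan_iff open_contains_cball vimageI)
  have rW: "cball p r \<subseteq> W" and rk: "\<And>q. q \<in> cball p r \<Longrightarrow> k * (\<Omega> q \<bullet> b) < 0"
    using r_sub by auto
  have seg_ball: "closed_segment q q' \<subseteq> cball p r" if "q \<in> cball p r" "q' \<in> cball p r" for q q'
    using that by (simp add: closed_segment_subset)
  \<comment> \<open>Half the radius goes to vertical displacements and half to horizontal ones, so
    that the box below lies in \<open>cball p r\<close>.\<close>
  define \<eta> where "\<eta> = r / 2"
  have \<eta>: "\<eta> > 0" "\<eta> \<le> r" using r by (auto simp: \<eta>_def)
  have vert: "p + (s * k) *\<^sub>R b \<in> cball p r" if "\<bar>s\<bar> \<le> \<eta>" for s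
    using that \<eta> k(2) by (simp add: dist_norm abs_mult)
  have up: "y + (s * k) *\<^sub>R b \<in> N" if "y \<in> E" "s > 0" "y \<in> cball p r" "y + (s * k) *\<^sub>R b \<in> cball p r" for y s
  proof (rule step[OF that(1)])
    show "closed_segment y (y + (s * k) *\<^sub>R b) \<subseteq> W" using seg_ball[OF that(3,4)] rW by blast
    fix \<xi> assume "\<xi> \<in> closed_segment y (y + (s * k) *\<^sub>R b)"
    then have "s * (k * (\<Omega> \<xi> \<bullet> b)) < 0"
      using mult_pos_neg[OF \<open>s > 0\<close> rk] seg_ball[OF that(3,4)] by blast
    then show "\<Omega> \<xi> \<bullet> (y + (s * k) *\<^sub>R b - y) < 0" by (simp add: mult.assoc)
  qed
  have top: "p + (\<eta> * k) *\<^sub>R b \<in> N"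
    using up[of p \<eta>] p \<eta> vert[of \<eta>] by auto
  \<comment> \<open>If this point were in \<open>E\<close>, the ascent by \<open>\<eta>\<close> from
    it would put \<open>p\<close> into \<open>N\<close>.\<close>
  have bot: "p - (\<eta> * k) *\<^sub>R b \<in> W - E"
  proof -
    have *: "p - (\<eta> * k) *\<^sub>R b \<in> cball p r" using vert[of "-\<eta>"] \<eta> by simp
    then have "p - (\<eta> * k) *\<^sub>R b \<notin> E"
      using up[of "p - (\<eta> * k) *\<^sub>R b" \<eta>] p \<eta> by auto
    with * rW show ?thesis by blast
  qed
  obtain \<delta>1 where \<delta>1: "\<delta>1 > 0" "ball (p + (\<eta> * k) *\<^sub>R b) \<delta>1 \<subseteq> N"
    using top \<open>open N\<close> by (meson open_contains_ball)
  obtain \<delta>2 where \<delta>2: "\<delta>2 > 0" "ball (p - (\<eta> * k) *\<^sub>R b) \<delta>2 \<subseteq> W - E"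
    using bot assms(3) by (meson open_contains_ball)
  \<comment> \<open>The box is so thin that its top lies in \<open>N\<close> and its bottom in
    \<open>W - E\<close>.\<close>
  define \<delta> where "\<delta> = min \<eta> (min \<delta>1 \<delta>2)"
  have \<delta>: "\<delta> > 0" "\<delta> \<le> \<eta>" "\<delta> \<le> \<delta>1" "\<delta> \<le> \<delta>2" using \<eta> \<delta>1 \<delta>2 by (auto simp: \<delta>_def)
  define \<pi> where "\<pi> = (\<lambda>y::'e. y - (y \<bullet> b) *\<^sub>R b)"
  have bl_\<pi>: "bounded_linear \<pi>"
    unfolding \<pi>_def by (intro bounded_linear_intros)
  interpret \<pi>: bounded_linear \<pi> by (rule bl_\<pi>)
  have \<pi>_b: "\<pi> (y + s *\<^sub>R b) = \<pi> y" for y s by (simp add: \<pi>_def algebra_simps)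
  have \<pi>_self: "\<pi> y \<bullet> z = y \<bullet> \<pi> z" for y z
    by (simp add: \<pi>_def inner_diff_left inner_diff_right inner_commute)
  \<comment> \<open>An unbounded cylinder, invariant under translations along \<open>b\<close> since
    the projection \<open>\<pi>\<close> kills \<open>b\<close>. The height is bounded only in
    \<open>V\<close> and \<open>P\<close>.\<close>
  define Y where "Y = {y. norm (\<pi> (y - p)) < \<delta>}"
  define V where "V = {y \<in> Y. \<bar>(y - p) \<bullet> b\<bar> < \<eta>}"

  \<comment> \<open>The height of the boundary over the hyperplane\<close>
  define P where "P = (\<lambda>y v. \<bar>v - p \<bullet> b\<bar> \<le> \<eta> \<and> \<pi> y + v *\<^sub>R b \<in> E - N)"
  define f where "f = (\<lambda>y. THE v. P y v)"
  define g where "g = (\<lambda>y. \<pi> y + f y *\<^sub>R b)"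
  have in_cball: "\<pi> y + v *\<^sub>R b \<in> cball p r" if "y \<in> Y" "\<bar>v - p \<bullet> b\<bar> \<le> \<eta>" for y v
  proof -
    have "\<pi> y + v *\<^sub>R b - p = \<pi> (y - p) + (v - p \<bullet> b) *\<^sub>R b"
      by (simp add: \<pi>_def algebra_simps)
    then have "norm (\<pi> y + v *\<^sub>R b - p) \<le> norm (\<pi> (y - p)) + \<bar>v - p \<bullet> b\<bar>"
      by (metis norm_triangle_ineq norm_scaleR bb(2) mult.right_neutral)
    also have "\<dots> \<le> r" using that \<delta> unfolding Y_def \<eta>_def by auto
    finally show ?thesis by (simp add: dist_norm norm_minus_commute)
  qed
  \<comment> \<open>The vertical segment over \<open>y\<close> joins \<open>N\<close> to
    \<open>W - E\<close>. If it avoided \<open>E - N\<close>, these disjoint open sets would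
    disconnect it.\<close>
  have ex: "\<exists>v. P y v" if "y \<in> Y" for y
  proof (rule ccontr)
    assume none: "\<nexists>v. P y v"
    let ?l = "p + \<pi> (y - p)"
    let ?S = "(\<lambda>s. ?l + (s * k) *\<^sub>R b) ` {-\<eta>..\<eta>}"
    have l: "?l + (s * k) *\<^sub>R b = \<pi> y + (p \<bullet> b + s * k) *\<^sub>R b" for s
      by (simp add: \<pi>_def algebra_simps)
    have sk: "\<bar>(p \<bullet> b + s * k) - p \<bullet> b\<bar> \<le> \<eta>" if "s \<in> {-\<eta>..\<eta>}" for s
      using that k(2) by (auto simp: abs_mult)
    have "connected ?S" by (intro connected_continuous_image continuous_intros) simp
    moreover have "?S \<subseteq> N \<union> (W - E)"
    proof
      fix q assume "q \<in> ?S"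
      then obtain s where s: "s \<in> {-\<eta>..\<eta>}" "q = \<pi> y + (p \<bullet> b + s * k) *\<^sub>R b" by (auto simp: l)
      then have "q \<in> W" using in_cball[OF that sk[OF s(1)]] rW by blast
      moreover have "q \<notin> E - N" using none sk[OF s(1)] s(2) by (auto simp: P_def)
      ultimately show "q \<in> N \<union> (W - E)" by blast
    qed
    moreover have "?l + (\<eta> * k) *\<^sub>R b \<in> ?S \<inter> N" 
    proof -
      have "?l + (\<eta> * k) *\<^sub>R b \<in> ball (p + (\<eta> * k) *\<^sub>R b) \<delta>1"
        using that \<delta> by (simp add: Y_def dist_norm)
      then show ?thesis using \<delta>1 \<eta> by auto
    qed
    moreover have "?l + (- \<eta> * k) *\<^sub>R b \<in> ?S \<inter> (W - E)" 
    proof -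
      have "?l + (- \<eta> * k) *\<^sub>R b \<in> ball (p - (\<eta> * k) *\<^sub>R b) \<delta>2"
        using that \<delta> by (simp add: Y_def dist_norm)
      then have "?l + (- \<eta> * k) *\<^sub>R b \<in> W - E" using \<delta>2 by blast
      moreover have "?l + (- \<eta> * k) *\<^sub>R b \<in> ?S" using \<eta> by (intro imageI) auto
      ultimately show ?thesis by blast
    qed
    moreover have "N \<inter> (W - E) \<inter> ?S = {}" using assms(5) by blast
    ultimately show False
      using connectedD[OF _ \<open>open N\<close> assms(3)] by blast
  qed
  have orth: "\<exists>\<xi>\<in>closed_segment (\<pi> y + v *\<^sub>R b) (\<pi> y' + v' *\<^sub>R b).
      \<Omega> \<xi> \<bullet> (\<pi> y' + v' *\<^sub>R b - (\<pi> y + v *\<^sub>R b)) = 0"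
    if "y \<in> Y" "y' \<in> Y" "P y v" "P y' v'" for y y' v v'
    using seg_ball[of "\<pi> y + v *\<^sub>R b" "\<pi> y' + v' *\<^sub>R b"] in_cball that rW
    by (intro exists_orthogonal_on_chord[OF cont _ step]) (auto simp: P_def)
  have \<Omega>b: "\<Omega> \<xi> \<bullet> b \<noteq> 0" if "\<xi> \<in> cball p r" for \<xi> using rk[OF that] by auto
  \<comment> \<open>The chord between two boundary points on one vertical line is a multiple of
    \<open>b\<close>. It is annihilated by \<open>\<Omega>\<close> at some point of the ball, where
    \<open>\<Omega>\<close> does not annihilate \<open>b\<close>, so the multiple is zero.\<close>
  have uniq: "v = v'" if vv: "y \<in> Y" "P y v" "P y v'" for y v v'
  proof -
    obtain \<xi> where "\<xi> \<in> closed_segment (\<pi> y + v *\<^sub>R b) (\<pi> y + v' *\<^sub>R b)"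
      "\<Omega> \<xi> \<bullet> (\<pi> y + v' *\<^sub>R b - (\<pi> y + v *\<^sub>R b)) = 0"
      using orth[OF vv(1,1,2,3)] by blast
    moreover have "\<Omega> \<xi> \<bullet> b \<noteq> 0"
      using \<Omega>b seg_ball[of "\<pi> y + v *\<^sub>R b" "\<pi> y + v' *\<^sub>R b"] in_cball vv calculation(1)
      unfolding P_def by blast
    ultimately show ?thesis by (simp add: inner_diff_right inner_add_right flip: left_diff_distrib)
  qed
  have Pf: "P y (f y)" if y: "y \<in> Y" for y
  proof -
    obtain v where "P y v" using ex[OF y] by blast
    then show ?thesis unfolding f_def by (rule theI) (rule uniq[OF y _ \<open>P y v\<close>])
  qed
  have Pf_iff: "P y v \<longleftrightarrow> v = f y" if "y \<in> Y" for y v using Pf uniq that by blast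
  have g_ball: "g y \<in> cball p r" if "y \<in> Y" for y
    using in_cball Pf that unfolding g_def P_def by blast

  \<comment> \<open>Regularity of the graph function\<close>
  define G where "G = (\<lambda>\<xi>. - (inverse (\<Omega> \<xi> \<bullet> b) *\<^sub>R \<pi> (\<Omega> \<xi>)))"
  have incr: "\<exists>\<xi>\<in>closed_segment (g y) (g y'). f y' - f y = G \<xi> \<bullet> (y' - y)" if yy: "y \<in> Y" "y' \<in> Y" for y y'
  proof -
    obtain \<xi> where \<xi>: "\<xi> \<in> closed_segment (g y) (g y')" "\<Omega> \<xi> \<bullet> (g y' - g y) = 0"
      using orth[OF yy Pf Pf] yy unfolding g_def by blast
    have "\<Omega> \<xi> \<bullet> b \<noteq> 0" using \<Omega>b seg_ball[OF g_ball g_ball] yy \<xi> by blast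
    \<comment> \<open>Solving this equation for the increment of \<open>f\<close>, with
      \<open>\<pi>\<close> moved to \<open>\<Omega> \<xi>\<close> by self-adjointness, yields the
      formula for \<open>G\<close>. The result is a mean value theorem for \<open>f\<close>,
      obtained before differentiability is known.\<close>
    moreover have "\<Omega> \<xi> \<bullet> \<pi> (y' - y) + (f y' - f y) * (\<Omega> \<xi> \<bullet> b) = 0"
      using \<xi>(2) by (simp add: g_def \<pi>.diff inner_diff_right inner_add_right left_diff_distrib)
    ultimately have "f y' - f y = G \<xi> \<bullet> (y' - y)"
      by (simp add: G_def \<pi>_self field_simps)
    then show ?thesis using \<xi>(1) by blast
  qed
  have contG: "continuous_on (cball p r) G"
    unfolding G_def
    by (intro continuous_intros bounded_linear.continuous_on[OF bl_\<pi>] continuous_on_subset[OF cont rW])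
      (use \<Omega>b in auto)
  then have "bounded (G ` cball p r)"
    by (intro compact_imp_bounded compact_continuous_image) auto
  then obtain M where M: "M > 0" "\<And>\<xi>. \<xi> \<in> cball p r \<Longrightarrow> norm (G \<xi>) \<le> M"
    by (auto simp: bounded_pos)
  have lip: "\<bar>f y' - f y\<bar> \<le> M * norm (y' - y)" if yy: "y \<in> Y" "y' \<in> Y" for y y'
  proof -
    obtain \<xi> where \<xi>: "\<xi> \<in> closed_segment (g y) (g y')" "f y' - f y = G \<xi> \<bullet> (y' - y)"
      using incr[OF yy] by blast
    have "\<bar>f y' - f y\<bar> \<le> norm (G \<xi>) * norm (y' - y)"
      unfolding \<xi>(2) by (rule Cauchy_Schwarz_ineq2)
    also have "\<dots> \<le> M * norm (y' - y)"
      using seg_ball[OF g_ball[OF yy(1)] g_ball[OF yy(2)]] \<xi>(1)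
      by (intro mult_right_mono[OF M(2)]) auto
    finally show ?thesis .
  qed
  have "open Y" unfolding Y_def
    by (intro open_Collect_less continuous_intros bounded_linear.continuous_on[OF bl_\<pi>])
  have contf: "continuous_on Y f"
  proof (rule continuous_on_iff[THEN iffD2], intro ballI allI impI)
    fix y and e :: real assume "y \<in> Y" "e > 0"
    have "dist (f y') (f y) < e" if "y' \<in> Y" "dist y' y < e / M" for y'
      using lip[OF \<open>y \<in> Y\<close> that(1)] that(2) M(1) by (simp add: dist_norm field_simps)
    then show "\<exists>d>0. \<forall>y'\<in>Y. dist y' y < d \<longrightarrow> dist (f y') (f y) < e"
      using \<open>e > 0\<close> M(1) by (intro exI[of _ "e / M"]) auto
  qed
  have contg: "continuous_on Y g"
    unfolding g_def by (intro continuous_intros bounded_linear.continuous_on[OF bl_\<pi>] contf)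
  \<comment> \<open>The point \<open>\<xi>\<close> given by \<open>incr\<close> is no farther from
    \<open>g y\<close> than \<open>g y'\<close> is. Continuity of \<open>g\<close>, which rests on
    the Lipschitz bound, and of \<open>G\<close> therefore makes \<open>G \<xi>\<close> tend to
    \<open>G (g y)\<close> as \<open>y'\<close> tends to \<open>y\<close>.\<close>
  have deriv: "(f has_derivative (\<lambda>h. G (g y) \<bullet> h)) (at y)" if y: "y \<in> Y" for y
    unfolding has_derivative_at_alt
  proof (intro conjI allI impI)
    show "bounded_linear ((\<bullet>) (G (g y)))" by (rule bounded_linear_inner_right)
    fix e :: real assume "e > 0"
    obtain d where d: "d > 0"
      "\<And>\<xi>. \<xi> \<in> cball p r \<Longrightarrow> dist \<xi> (g y) < d \<Longrightarrow> dist (G \<xi>) (G (g y)) < e"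
      using contG g_ball[OF y] \<open>e > 0\<close> unfolding continuous_on_iff by metis
    obtain d' where d': "d' > 0" "\<And>y'. y' \<in> Y \<Longrightarrow> dist y' y < d' \<Longrightarrow> dist (g y') (g y) < d"
      using contg y d(1) unfolding continuous_on_iff by metis
    obtain d'' where d'': "d'' > 0" "ball y d'' \<subseteq> Y"
      using \<open>open Y\<close> y by (meson open_contains_ball)
    have "norm (f y' - f y - G (g y) \<bullet> (y' - y)) \<le> e * norm (y' - y)" if "norm (y' - y) < min d' d''" for y'
    proof -
      have y': "y' \<in> Y" using that d''(2) by (auto simp: dist_norm norm_minus_commute)
      obtain \<xi> where \<xi>: "\<xi> \<in> closed_segment (g y) (g y')" "f y' - f y = G \<xi> \<bullet> (y' - y)"
        using incr[OF y y'] by blast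
      have "dist (G \<xi>) (G (g y)) < e"
      proof (rule d(2))
        show "\<xi> \<in> cball p r" using seg_ball[OF g_ball[OF y] g_ball[OF y']] \<xi>(1) by blast
        have "dist \<xi> (g y) \<le> dist (g y') (g y)"
          using \<xi>(1) by (metis dist_commute dist_in_closed_segment)
        then show "dist \<xi> (g y) < d" using d'(2)[OF y'] that by (simp add: dist_norm)
      qed
      then have "norm (G \<xi> - G (g y)) * norm (y' - y) \<le> e * norm (y' - y)"
        by (intro mult_right_mono) (auto simp: dist_norm)
      moreover have "f y' - f y - G (g y) \<bullet> (y' - y) = (G \<xi> - G (g y)) \<bullet> (y' - y)"
        by (simp add: \<xi>(2) inner_diff_left)
      ultimately show ?thesis
        using Cauchy_Schwarz_ineq2[of "G \<xi> - G (g y)" "y' - y"] by (metis order.trans real_norm_def)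
    qed
    then show "\<exists>d>0. \<forall>y'. norm (y' - y) < d \<longrightarrow>
        norm (f y' - f y - G (g y) \<bullet> (y' - y)) \<le> e * norm (y' - y)"
      using d'(1) d''(1) by (intro exI[of _ "min d' d''"]) auto
  qed
  have "smooth_on f Y"
    unfolding smooth_on_def
  proof
    fix n show "cont_diff_on n f Y"
    proof (induction n)
      case 0
      then show ?case using contf by simp
    next
      case (Suc n)
      \<comment> \<open>An open set containing the graph on which \<open>G\<close> is smooth. Since
        \<open>g\<close> is built from \<open>f\<close>, order \<open>n\<close> for \<open>f\<close>
        gives order \<open>n\<close> for the derivative \<open>G (g y)\<close>, and thus order
        \<open>Suc n\<close> for \<open>f\<close>.\<close>
      define Z where "Z = W \<inter> (\<lambda>\<xi>. \<Omega> \<xi> \<bullet> b) -` (- {0})"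
      have "open Z" unfolding Z_def
        by (intro continuous_open_preimage continuous_intros cont \<open>open W\<close>)
      have \<Omega>Z: "cont_diff_on n \<Omega> Z"
        using smooth cont_diff_on_subset[of n \<Omega> W Z] by (auto simp: smooth_on_def Z_def)
      have "cont_diff_on n (\<lambda>\<xi>. inverse (\<Omega> \<xi> \<bullet> b) *\<^sub>R \<pi> (\<Omega> \<xi>)) Z"
        by (intro cont_diff_on_scaleR cont_diff_on_inverse \<open>open Z\<close>
            cont_diff_on_bounded_linear[OF \<open>open Z\<close> bl_\<pi> \<Omega>Z]
            cont_diff_on_bounded_linear[OF \<open>open Z\<close> bounded_linear_inner_left \<Omega>Z])
          (auto simp: Z_def)
      then have GZ: "cont_diff_on n (\<lambda>\<xi>. G \<xi> \<bullet> v) Z" for v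
        unfolding G_def
        by (intro cont_diff_on_bounded_linear[OF \<open>open Z\<close>, of "\<lambda>x. - x \<bullet> v"])
          (auto intro: bounded_linear_minus bounded_linear_inner_left)
      have "cont_diff_on n (\<lambda>y. f y *\<^sub>R b) Y"
        by (rule cont_diff_on_bounded_linear[OF \<open>open Y\<close> bounded_linear_scaleR_left Suc])
      then have "cont_diff_on n g Y"
        unfolding g_def
        by (intro cont_diff_on_add cont_diff_on_bounded_linear[OF _ bl_\<pi>] cont_diff_on_id \<open>open Y\<close>)
      moreover have "g ` Y \<subseteq> Z"
        using g_ball rW \<Omega>b unfolding Z_def by blast
      ultimately have "cont_diff_on n (\<lambda>y. G (g y) \<bullet> v) Y" for v
        using cont_diff_on_compose[OF \<open>open Y\<close> \<open>open Z\<close> _ GZ] by blast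
      then show ?case by (intro cont_diff_on_SucI[OF \<open>open Y\<close> deriv])
    qed
  qed
  moreover have "open V"
    unfolding V_def using \<open>open Y\<close> 
    by (subst Collect_conj_eq, simp, intro open_Int open_Collect_less continuous_intros) auto
  moreover have "p \<in> V" using \<delta> \<eta> by (simp add: V_def Y_def \<pi>.zero)
  moreover have rep: "\<pi> y + (y \<bullet> b) *\<^sub>R b = y" for y by (simp add: \<pi>_def)
  moreover have Vb: "\<bar>y \<bullet> b - p \<bullet> b\<bar> \<le> \<eta>" if "y \<in> V" for y using that by (auto simp: V_def inner_diff_left)
  moreover have "V \<subseteq> W"
    using in_cball[of _ "_ \<bullet> b"] rep Vb rW unfolding V_def by (metis (no_types, lifting) mem_Collect_eq subset_iff)
  moreover have "y \<in> E - N \<longleftrightarrow> y \<bullet> b = f y" if "y \<in> V" for y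
    using Pf_iff[of y "y \<bullet> b"] that Vb[OF that] rep[of y] unfolding P_def V_def by auto
  moreover have "y + s *\<^sub>R b \<in> Y \<longleftrightarrow> y \<in> Y" for y s
    using \<pi>_b[of "y - p" s] by (simp add: Y_def algebra_simps)
  moreover have "f (y + s *\<^sub>R b) = f y" for y s by (simp add: f_def P_def \<pi>_b)
  ultimately show thesis
    using that[of b V Y f] b(1) \<open>open Y\<close> V_def by blast
qed


section \<open>Charts, tangent vectors and curves\<close>

text \<open>The inverse in \<open>is_chart\<close> is only asserted to exist. It makes
  \<open>snd c\<close> injective on the domain, so the choice made by \<open>inv_into\<close> agrees
  with it on the image.\<close>

lemma is_chart_homeomorphism:
  assumes "is_chart c"
  shows "homeomorphism (fst c) (snd c ` fst c) (snd c) (chart_inv c)"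
proof -
  obtain \<psi> where \<psi>: "homeomorphism (fst c) (snd c ` fst c) (snd c) \<psi>"
    using assms unfolding is_chart_def by blast
  then have "inj_on (snd c) (fst c)" by (intro inj_on_inverseI[of _ \<psi>]) (simp add: homeomorphism_apply1)
  then have "chart_inv c y = \<psi> y" if "y \<in> snd c ` fst c" for y
    using that homeomorphism_apply1[OF \<psi>] by (auto simp: chart_inv_def)
  then show ?thesis by (intro homeomorphism_cong[OF \<psi>]) auto
qed

locale smooth_manifold =
  fixes A :: "('a::{t2_space,second_countable_topology}, 'e::euclidean_space) chart set"
  assumes atlas: "smooth_structure A"
begin

lemma chart: "c \<in> A \<Longrightarrow> is_chart c"
  using atlas by (auto simp: smooth_structure_def)

lemma open_chart_domain: "c \<in> A \<Longrightarrow> open (fst c)"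
  using chart by (auto simp: is_chart_def)

lemma open_chart_image: "c \<in> A \<Longrightarrow> open (snd c ` fst c)"
  using chart by (auto simp: is_chart_def)

lemma homeo: "c \<in> A \<Longrightarrow> homeomorphism (fst c) (snd c ` fst c) (snd c) (chart_inv c)"
  by (rule is_chart_homeomorphism[OF chart])

lemma chart_inv_chart [simp]: "c \<in> A \<Longrightarrow> p \<in> fst c \<Longrightarrow> chart_inv c (snd c p) = p"
  using homeomorphism_apply1[OF homeo] .

lemma chart_chart_inv [simp]: "c \<in> A \<Longrightarrow> y \<in> snd c ` fst c \<Longrightarrow> snd c (chart_inv c y) = y"
  using homeomorphism_apply2[OF homeo] .

lemma chart_inv_in_domain: "c \<in> A \<Longrightarrow> y \<in> snd c ` fst c \<Longrightarrow> chart_inv c y \<in> fst c"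
  by auto

lemma continuous_on_chart: "c \<in> A \<Longrightarrow> continuous_on (fst c) (snd c)"
  using homeomorphism_cont1[OF homeo] .

lemma continuous_on_chart_inv: "c \<in> A \<Longrightarrow> continuous_on (snd c ` fst c) (chart_inv c)"
  using homeomorphism_cont2[OF homeo] .

lemma exists_chart_at: "\<exists>c\<in>A. p \<in> fst c"
  using atlas unfolding smooth_structure_def by blast

lemma open_chart_preimage: "c \<in> A \<Longrightarrow> open V \<Longrightarrow> open (fst c \<inter> snd c -` V)"
  by (intro continuous_open_preimage continuous_on_chart open_chart_domain)

lemma open_chart_image_Int:
  assumes "c \<in> A" "open U"
  shows "open (snd c ` (fst c \<inter> U))"
proof -
  have "openin (top_of_set (snd c ` fst c)) (snd c ` (fst c \<inter> U))"
    by (rule homeomorphism_imp_open_map[OF homeo[OF assms(1)]]) (use assms(2) in auto)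
  then show ?thesis using open_chart_image[OF assms(1)] openin_open_trans by blast
qed

lemma open_chart_inv_image:
  assumes "c \<in> A" "open V" "V \<subseteq> snd c ` fst c"
  shows "open (chart_inv c ` V)"
proof -
  have "chart_inv c ` V = fst c \<inter> snd c -` V"
    using assms by (auto simp: image_iff) (metis chart_inv_chart)
  then show ?thesis using open_chart_preimage assms by simp
qed

lemma smooth_transition:
  "c \<in> A \<Longrightarrow> d \<in> A \<Longrightarrow> smooth_on (transition c d) (snd c ` (fst c \<inter> fst d))"
  using atlas unfolding smooth_structure_def smoothly_compatible_def by blast

lemma open_transition_domain: "c \<in> A \<Longrightarrow> d \<in> A \<Longrightarrow> open (snd c ` (fst c \<inter> fst d))"
  by (intro open_chart_image_Int open_chart_domain)

lemma transition_chart [simp]: "c \<in> A \<Longrightarrow> p \<in> fst c \<Longrightarrow> transition c d (snd c p) = snd d p"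
  by (simp add: transition_def)

lemma transition_has_derivative:
  assumes "c \<in> charts_at A p" "d \<in> charts_at A p"
  shows "(transition c d has_derivative frechet_derivative (transition c d) (at (snd c p))) (at (snd c p))"
  using assms by (intro smooth_on_has_derivative[OF smooth_transition]) (auto simp: charts_at_def)

text \<open>The cocycle rule, by the chain rule: passing from \<open>c\<close> to \<open>e\<close>
  directly or through \<open>d\<close> is the same map on the open image of the overlap of
  \<open>c\<close> and \<open>d\<close>. It makes \<open>coord_vector\<close> a consistent family of
  components.\<close>

lemma frechet_derivative_transition_trans:
  assumes "c \<in> charts_at A p" "d \<in> charts_at A p" "e \<in> charts_at A p"
  shows "frechet_derivative (transition c e) (at (snd c p)) w =
    frechet_derivative (transition d e) (at (snd d p))
      (frechet_derivative (transition c d) (at (snd c p)) w)"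
proof -
  have cde: "c \<in> A" "d \<in> A" "e \<in> A" "p \<in> fst c" "p \<in> fst d" "p \<in> fst e"
    using assms by (auto simp: charts_at_def)
  have "(transition d e has_derivative frechet_derivative (transition d e) (at (snd d p)))
      (at (transition c d (snd c p)))"
    using transition_has_derivative[OF assms(2,3)] cde by simp
  from has_derivative_compose[OF transition_has_derivative[OF assms(1,2)] this]
  have "(transition c e has_derivative (\<lambda>w. frechet_derivative (transition d e) (at (snd d p))
      (frechet_derivative (transition c d) (at (snd c p)) w))) (at (snd c p))"
    by (rule has_derivative_transform_within_open[OF _ open_transition_domain[of c d]])
      (use cde in \<open>auto simp: transition_def\<close>)
  from frechet_derivative_at[OF this] show ?thesis by metis
qed

lemma coord_vector_in_tangent_space:
  "c \<in> charts_at A p \<Longrightarrow> coord_vector A c w p \<in> tangent_space A p"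
  by (simp add: tangent_space_def coord_vector_def frechet_derivative_transition_trans[symmetric])

text \<open>One component determines all others through the transition maps, and the components at
  foreign charts are zero on both sides.\<close>

lemma tangent_vector_eq_coord_vector:
  assumes "v \<in> tangent_space A p" "c \<in> charts_at A p"
  shows "v = coord_vector A c (v c) p"
proof
  fix d
  show "v d = coord_vector A c (v c) p d"
  proof (cases "d \<in> charts_at A p")
    case True
    then have "v d = frechet_derivative (transition c d) (at (snd c p)) (v c)"
      using assms unfolding tangent_space_def by blast
    then show ?thesis unfolding coord_vector_def using True by presburger
  next
    case False
    then have "v d = 0" using assms unfolding tangent_space_def by blast
    then show ?thesis unfolding coord_vector_def using False by presburger
  qed
qed

lemma coord_vector_linear:
  assumes "c \<in> charts_at A p"
  shows "coord_vector A c (s *\<^sub>R v + t *\<^sub>R w) p =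
    (\<lambda>d. s *\<^sub>R coord_vector A c v p d + t *\<^sub>R coord_vector A c w p d)"
proof
  fix d
  show "coord_vector A c (s *\<^sub>R v + t *\<^sub>R w) p d =
    s *\<^sub>R coord_vector A c v p d + t *\<^sub>R coord_vector A c w p d"
  proof (cases "d \<in> charts_at A p")
    case True
    then have "linear (frechet_derivative (transition c d) (at (snd c p)))"
      using transition_has_derivative[OF assms] has_derivative_linear by blast
    then show ?thesis using True by (simp add: coord_vector_def linear_add linear_scale)
  qed (simp add: coord_vector_def)
qed

lemma coordinate_curve_has_vector_derivative:
  assumes "c \<in> A" "d \<in> A" "u t \<in> snd c ` (fst c \<inter> fst d)"
    and "(u has_vector_derivative w) (at t within I)"
  shows "((\<lambda>\<tau>. transition c d (u \<tau>)) has_vector_derivative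
    frechet_derivative (transition c d) (at (u t)) w) (at t within I)"
proof -
  let ?D = "frechet_derivative (transition c d) (at (u t))"
  have D: "(transition c d has_derivative ?D) (at (u t))"
    using smooth_on_has_derivative[OF smooth_transition] assms by blast
  have "((\<lambda>\<tau>. transition c d (u \<tau>)) has_derivative (\<lambda>h. ?D (h *\<^sub>R w))) (at t within I)"
    using has_derivative_compose[OF assms(4)[unfolded has_vector_derivative_def] D] .
  then show ?thesis
    unfolding has_vector_derivative_def using linear_scale[OF has_derivative_linear[OF D]] by simp
qed

text \<open>By the chain rule a derivative in the single chart \<open>c\<close> determines the
  derivative in every other chart at the point, so curves may be treated in one chart.\<close>

lemma coordinate_curve_has_velocity:
  assumes "c \<in> A" "u t \<in> snd c ` fst c" "(u has_vector_derivative w) (at t within I)"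
  shows "has_velocity A (\<lambda>\<tau>. chart_inv c (u \<tau>)) (coord_vector A c w (chart_inv c (u t))) t I"
proof -
  let ?p = "chart_inv c (u t)"
  have c: "c \<in> charts_at A ?p" using assms chart_inv_in_domain by (auto simp: charts_at_def)
  have "((snd d \<circ> (\<lambda>\<tau>. chart_inv c (u \<tau>))) has_vector_derivative coord_vector A c w ?p d) (at t within I)"
    if d: "d \<in> charts_at A ?p" for d
  proof -
    have "u t \<in> snd c ` (fst c \<inter> fst d)"
      using c d assms by (auto simp: charts_at_def intro!: image_eqI[of _ _ ?p])
    then show ?thesis
      using coordinate_curve_has_vector_derivative[of c d u t w I] assms c d
      by (simp add: coord_vector_def charts_at_def transition_def comp_def)
  qed
  then show ?thesis
    unfolding has_velocity_def using coord_vector_in_tangent_space[OF c] by blast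
qed

text \<open>Absolute continuity is demanded in every chart of the atlas. In another chart the
  derivative of the segment is continuous on a compact interval, hence bounded, and the mean value
  inequality makes the segment Lipschitz.\<close>

lemma abs_continuous_curve_segment:
  assumes c: "c \<in> A" and u: "\<And>t. t \<in> {a..b} \<Longrightarrow> y + (t - a) *\<^sub>R w \<in> snd c ` fst c"
  shows "abs_continuous_curve A a b (\<lambda>t. chart_inv c (y + (t - a) *\<^sub>R w))"
proof -
  let ?u = "\<lambda>t. y + (t - a) *\<^sub>R w"
  have "abs_continuous_on s t (snd d \<circ> (\<lambda>t. chart_inv c (?u t)))"
    if d: "d \<in> A" and st: "{s..t} \<subseteq> {a..b}" "(\<lambda>t. chart_inv c (?u t)) ` {s..t} \<subseteq> fst d" for d s t
  proof -
    let ?T = "snd c ` (fst c \<inter> fst d)"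
    let ?D = "\<lambda>\<tau>. frechet_derivative (transition c d) (at (?u \<tau>)) w"
    have uT: "?u ` {s..t} \<subseteq> ?T"
    proof
      fix z assume "z \<in> ?u ` {s..t}"
      then obtain \<tau> where \<tau>: "\<tau> \<in> {s..t}" "z = ?u \<tau>" by blast
      then have "z \<in> snd c ` fst c" using u st(1) by blast
      moreover have "chart_inv c z \<in> fst d" using \<tau> st(2) by blast
      ultimately show "z \<in> ?T"
        using c by (intro image_eqI[of _ _ "chart_inv c z"]) (auto intro: chart_inv_in_domain)
    qed
    have "cont_diff_on (Suc 0) (transition c d) ?T"
      using smooth_transition[OF c d] unfolding smooth_on_def by blast
    then have "continuous_on ?T (\<lambda>z. frechet_derivative (transition c d) (at z) w)" by simp
    then have "continuous_on {s..t} ?D"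
      by (rule continuous_on_compose2[OF _ _ uT]) (intro continuous_intros)
    then have "bounded (?D ` {s..t})"
      by (intro compact_imp_bounded compact_continuous_image) auto
    then obtain B where "\<forall>z\<in>?D ` {s..t}. norm z \<le> B" unfolding bounded_iff by blast
    then have B: "norm (?D \<tau>) \<le> B" if "\<tau> \<in> {s..t}" for \<tau> using that by blast
    have deriv: "((\<lambda>\<tau>. transition c d (?u \<tau>)) has_derivative (\<lambda>h. h *\<^sub>R ?D \<tau>)) (at \<tau> within {s..t})"
      if "\<tau> \<in> {s..t}" for \<tau>
    proof -
      have "(?u has_vector_derivative w) (at \<tau> within {s..t})"
        by (auto intro!: derivative_eq_intros)
      moreover have "?u \<tau> \<in> ?T" using uT that by blast
      ultimately show ?thesis
        using coordinate_curve_has_vector_derivative[OF c d, of ?u \<tau> w "{s..t}"]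
        unfolding has_vector_derivative_def by simp
    qed
    show ?thesis
    proof (rule abs_continuous_on_lipschitz)
      fix \<sigma> \<tau> assume le: "s \<le> \<sigma>" "\<sigma> \<le> \<tau>" "\<tau> \<le> t"
      have "norm (transition c d (?u \<tau>) - transition c d (?u \<sigma>)) \<le> B * norm (\<tau> - \<sigma>)"
      proof (rule differentiable_bound[OF _ deriv])
        fix \<tau> assume "\<tau> \<in> {s..t}"
        then show "onorm (\<lambda>h. h *\<^sub>R ?D \<tau>) \<le> B"
          using mult_left_mono[OF B abs_ge_zero] by (intro onorm_le) (simp add: mult.commute)
      qed (use le in auto)
      then show "norm ((snd d \<circ> (\<lambda>t. chart_inv c (?u t))) \<tau> - (snd d \<circ> (\<lambda>t. chart_inv c (?u t))) \<sigma>)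
          \<le> B * (\<tau> - \<sigma>)"
        using le by (simp add: transition_def)
    qed
  qed
  moreover have "continuous_on {a..b} (\<lambda>t. chart_inv c (?u t))"
    by (rule continuous_on_compose2[OF continuous_on_chart_inv[OF c]])
      (use u in \<open>auto intro!: continuous_intros\<close>)
  ultimately show ?thesis unfolding abs_continuous_curve_def by blast
qed

text \<open>Maximality of the atlas admits every compatible chart, and the transitions of the new
  one are those of \<open>c\<close> composed with \<open>\<Phi>\<close> or \<open>\<Psi>\<close>.
  This is how the chart that flattens the boundary is found in \<open>A\<close>.\<close>

lemma diffeomorphism_comp_chart_in_structure:
  assumes c: "c \<in> A" and V: "open V" "V \<subseteq> snd c ` fst c" "open (\<Phi> ` V)"
    and \<Phi>: "smooth_on \<Phi> V" and \<Psi>: "smooth_on \<Psi> (\<Phi> ` V)" "\<And>y. y \<in> V \<Longrightarrow> \<Psi> (\<Phi> y) = y"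
  shows "(fst c \<inter> snd c -` V, \<Phi> \<circ> snd c) \<in> A" (is "?c \<in> A")
proof -
  let ?U = "fst c \<inter> snd c -` V"
  have img: "(\<Phi> \<circ> snd c) ` ?U = \<Phi> ` V" using V(2) by force
  have cont: "continuous_on V \<Phi>" "continuous_on (\<Phi> ` V) \<Psi>"
    using \<Phi> \<Psi>(1) unfolding smooth_on_def by (metis cont_diff_on.simps(1))+
  have inv: "chart_inv c (\<Psi> (\<Phi> (snd c q))) = q" if "q \<in> ?U" for q using that \<Psi>(2) c by simp
  have homeo': "homeomorphism ?U (\<Phi> ` V) (\<Phi> \<circ> snd c) (chart_inv c \<circ> \<Psi>)"
  proof (rule homeomorphismI)
    show "continuous_on ?U (\<Phi> \<circ> snd c)"
      by (intro continuous_on_compose continuous_on_subset[OF continuous_on_chart[OF c]]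
          continuous_on_subset[OF cont(1)]) auto
    show "continuous_on (\<Phi> ` V) (chart_inv c \<circ> \<Psi>)"
      by (intro continuous_on_compose cont(2) continuous_on_subset[OF continuous_on_chart_inv[OF c]])
        (use \<Psi>(2) V(2) in auto)
    show "(chart_inv c \<circ> \<Psi>) ` \<Phi> ` V \<subseteq> ?U"
      using \<Psi>(2) V(2) c chart_inv_in_domain by (auto simp: subset_iff)
  qed (use inv \<Psi>(2) V(2) c in auto)
  have openU: "open ?U" using open_chart_preimage c V(1) by blast
  have chart': "is_chart ?c"
    unfolding is_chart_def using homeo' openU V(3) img by auto
  \<comment> \<open>The left side chooses a preimage under another map in a smaller domain;
    injectivity there forces the choice.\<close>
  have inv': "chart_inv ?c z = chart_inv c (\<Psi> z)" if "z \<in> \<Phi> ` V" for z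
  proof -
    have "inj_on (\<Phi> \<circ> snd c) ?U" using inv by (intro inj_on_inverseI[of _ "chart_inv c \<circ> \<Psi>"]) simp
    then show ?thesis unfolding chart_inv_def[of ?c]
      using homeo' that by (auto intro!: inv_into_f_eq simp: homeomorphism_def)
  qed
  have "smoothly_compatible ?c d" if d: "d \<in> A" for d
    unfolding smoothly_compatible_def
  proof
    let ?S = "(\<Phi> \<circ> snd c) ` (?U \<inter> fst d)"
    have "openin (top_of_set (\<Phi> ` V)) ?S"
      by (rule homeomorphism_imp_open_map[OF homeo']) (use open_chart_domain[OF d] in auto)
    then have S: "open ?S" "?S \<subseteq> \<Phi> ` V" using V(3) openin_open_trans by (blast, auto)
    have "smooth_on (\<lambda>z. transition c d (\<Psi> z)) ?S"
      by (rule smooth_on_compose[OF S(1) open_transition_domain[OF c d] _ smooth_transition[OF c d]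
            smooth_on_subset[OF \<Psi>(1) S(2)]]) (use \<Psi>(2) in auto)
    then have "smooth_on (transition ?c d) ?S"
      by (rule smooth_on_cong[OF S(1)]) (use S(2) inv' in \<open>auto simp: transition_def\<close>)
    then show "smooth_on (transition ?c d) (snd ?c ` (fst ?c \<inter> fst d))" by simp
    let ?T = "snd d ` (fst d \<inter> ?U)"
    have "smooth_on (\<lambda>y. \<Phi> (transition d c y)) ?T"
      by (rule smooth_on_compose[OF open_chart_image_Int[OF d openU] V(1) _ \<Phi>
            smooth_on_subset[OF smooth_transition[OF d c]]]) (use d in auto)
    then show "smooth_on (transition d ?c) (snd d ` (fst ?c \<inter> fst d))"
      by (simp add: transition_def comp_def Int_commute)
  qed
  then show ?thesis using chart' atlas unfolding smooth_structure_def by blast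
qed

end

text \<open>The pieces match at \<open>m\<close>, and an interval across \<open>m\<close> is treated
  by \<open>abs_continuous_on_join\<close>. At \<open>m\<close> itself the two one-sided velocities
  may differ, but a single time is negligible; at any other time the velocity is that of one
  piece.\<close>

lemma admissible_join:
  assumes adm: "admissible A \<omega> a m \<gamma>" "admissible A \<omega> m b \<gamma>'" and "\<gamma> m = \<gamma>' m" "a \<le> m" "m \<le> b"
  shows "admissible A \<omega> a b (\<lambda>t. if t \<le> m then \<gamma> t else \<gamma>' t)" (is "admissible A \<omega> a b ?\<gamma>")
proof -
  have eq: "?\<gamma> t = \<gamma> t" if "t \<in> {..m}" for t using that by simp
  have eq': "?\<gamma> t = \<gamma>' t" if "t \<in> {m..}" for t using that assms(3) by auto
  have ac: "abs_continuous_curve A a m \<gamma>" "abs_continuous_curve A m b \<gamma>'"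
    using adm by (auto simp: admissible_def)
  have cont: "continuous_on {a..m} ?\<gamma>"
    by (rule continuous_on_eq[of _ \<gamma>]) (use ac(1) in \<open>auto simp: abs_continuous_curve_def\<close>)
  have cont': "continuous_on {m..b} ?\<gamma>"
    by (rule continuous_on_eq[of _ \<gamma>']) (use ac(2) assms(3) in \<open>auto simp: abs_continuous_curve_def\<close>)
  have "{a..b} = {a..m} \<union> {m..b}" using assms by auto
  then have "continuous_on {a..b} ?\<gamma>"
    using continuous_on_closed_Un[OF _ _ cont cont'] by simp
  moreover have "abs_continuous_on s t (snd c \<circ> ?\<gamma>)"
    if c: "c \<in> A" and st: "{s..t} \<subseteq> {a..b}" "?\<gamma> ` {s..t} \<subseteq> fst c" for c s t
  proof -
    have left: "abs_continuous_on s' t' (snd c \<circ> ?\<gamma>)" if "{s'..t'} \<subseteq> {s..t}" "t' \<le> m" for s' t'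
    proof (rule abs_continuous_on_cong)
      have "\<gamma> ` {s'..t'} \<subseteq> fst c" using that st(2) eq by force
      moreover have "{s'..t'} \<subseteq> {a..m}" using that st(1) by auto
      ultimately show "abs_continuous_on s' t' (snd c \<circ> \<gamma>)"
        using ac(1) c unfolding abs_continuous_curve_def by blast
    qed (use that in auto)
    have right: "abs_continuous_on s' t' (snd c \<circ> ?\<gamma>)" if "{s'..t'} \<subseteq> {s..t}" "m \<le> s'" for s' t'
    proof (rule abs_continuous_on_cong)
      have eqs: "\<gamma>' \<tau> = ?\<gamma> \<tau>" if "\<tau> \<in> {s'..t'}" for \<tau>
        using that \<open>m \<le> s'\<close> by (intro eq'[symmetric]) simp
      then show "(snd c \<circ> \<gamma>') \<tau> = (snd c \<circ> ?\<gamma>) \<tau>" if "\<tau> \<in> {s'..t'}" for \<tau>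
        using that unfolding comp_def by metis
      have "\<gamma>' ` {s'..t'} = ?\<gamma> ` {s'..t'}" by (rule image_cong[OF refl eqs])
      then have "\<gamma>' ` {s'..t'} \<subseteq> fst c" using that(1) st(2) by blast
      moreover have "{s'..t'} \<subseteq> {m..b}" using that st(1) by auto
      ultimately show "abs_continuous_on s' t' (snd c \<circ> \<gamma>')"
        using ac(2) c unfolding abs_continuous_curve_def by blast
    qed
    consider "t \<le> m" | "m \<le> s" | "s \<le> m" "m \<le> t" by linarith
    then show ?thesis
    proof cases
      case 3
      then show ?thesis by (intro abs_continuous_on_join[of s m _ t] left right) auto
    qed (auto intro: left right)
  qed
  moreover have "AE t in lebesgue. t \<in> {a..b} \<longrightarrow>
      (\<exists>v. has_velocity A ?\<gamma> v t {a..b} \<and> (?\<gamma> t, v) \<in> open_half_bundle A \<omega>)"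
  proof -
    \<comment> \<open>Velocities are derivatives within the parameter interval. Since
      \<open>J\<close> and \<open>{a..b}\<close> coincide in the neighbourhood \<open>Q\<close> of
      \<open>t\<close>, so do the two limits, including those at the outer end points.\<close>
    have vel: "has_velocity A ?\<gamma> v t {a..b}"
      if v: "has_velocity A \<beta> v t J" and t: "t \<in> J" "J \<subseteq> {a..b}" and \<beta>: "\<And>s. s \<in> J \<Longrightarrow> ?\<gamma> s = \<beta> s"
        and Q: "open Q" "t \<in> Q" "Q \<inter> {a..b} \<subseteq> J" for \<beta> v t J Q
    proof -
      have at: "at t within {a..b} = at t within J"
        by (rule at_within_nhd[OF Q(2,1)]) (use t Q in auto)
      have eqt: "?\<gamma> t = \<beta> t" by (rule \<beta>[OF t(1)])
      show ?thesis unfolding has_velocity_def eqt at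
      proof (intro conjI ballI)
        show "v \<in> tangent_space A (\<beta> t)" using v unfolding has_velocity_def by blast
        fix c assume "c \<in> charts_at A (\<beta> t)"
        then have d: "((snd c \<circ> \<beta>) has_vector_derivative v c) (at t within J)"
          using v unfolding has_velocity_def by blast
        show "((snd c \<circ> ?\<gamma>) has_vector_derivative v c) (at t within J)"
          by (rule has_vector_derivative_transform[OF t(1) _ d]) (simp only: comp_def \<beta>)
      qed
    qed
    have "AE t in lebesgue. t \<noteq> m"
      by (rule AE_I'[of "{m}"]) (auto simp: null_sets_def)
    moreover have "AE t in lebesgue. t \<in> {a..m} \<longrightarrow>
        (\<exists>v. has_velocity A \<gamma> v t {a..m} \<and> (\<gamma> t, v) \<in> open_half_bundle A \<omega>)"
      "AE t in lebesgue. t \<in> {m..b} \<longrightarrow>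
        (\<exists>v. has_velocity A \<gamma>' v t {m..b} \<and> (\<gamma>' t, v) \<in> open_half_bundle A \<omega>)"
      using adm by (auto simp: admissible_def)
    ultimately show ?thesis
    proof eventually_elim
      case (elim t)
      show ?case
      proof
        assume t: "t \<in> {a..b}"
        show "\<exists>v. has_velocity A ?\<gamma> v t {a..b} \<and> (?\<gamma> t, v) \<in> open_half_bundle A \<omega>"
        proof (cases "t < m")
          case True
          then obtain v where "has_velocity A \<gamma> v t {a..m}" "(\<gamma> t, v) \<in> open_half_bundle A \<omega>"
            using elim t by auto
          moreover have "{..<m} \<inter> {a..b} \<subseteq> {a..m}" by auto
          ultimately show ?thesis
            using vel[of \<gamma> v t "{a..m}" "{..<m}"] True t assms(5) by auto
        next
          case False
          then have "m < t" using elim(1) by simp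
          then obtain v where v: "has_velocity A \<gamma>' v t {m..b}" "(\<gamma>' t, v) \<in> open_half_bundle A \<omega>"
            using elim t by auto
          have "has_velocity A ?\<gamma> v t {a..b}"
            by (rule vel[OF v(1) _ _ eq' open_greaterThan[of m]]) (use \<open>m < t\<close> t assms(4) in auto)
          then show ?thesis using v(2) \<open>m < t\<close> by auto
        qed
      qed
    qed
  qed
  ultimately show ?thesis
    unfolding admissible_def abs_continuous_curve_def by blast
qed


section \<open>The reachable set\<close>

locale nonvanishing_one_form = smooth_manifold A
  for A :: "('a::{t2_space,second_countable_topology}, 'e::euclidean_space) chart set" +
  fixes \<omega> :: "'a \<Rightarrow> ('a, 'e) tangent_vector \<Rightarrow> real"
  assumes form: "smooth_one_form A \<omega>" and nonvanishing: "nowhere_vanishing A \<omega>"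
begin

text \<open>The coordinate expression of \<open>\<omega>\<close>, turned from a covector into a
  vector by the inner product. It plays the part of \<open>\<Omega>\<close> in the Euclidean
  lemmas.\<close>

definition dual_vector :: "('a, 'e) chart \<Rightarrow> 'e \<Rightarrow> 'e" where
  "dual_vector c y = (\<Sum>b\<in>Basis. \<omega> (chart_inv c y) (coord_vector A c b (chart_inv c y)) *\<^sub>R b)"

text \<open>Coordinate vectors depend linearly on their components and \<open>\<omega>\<close> is
  linear on tangent vectors, so the values on \<open>Basis\<close> determine all others.\<close>

lemma inner_dual_vector:
  assumes "c \<in> A" "y \<in> snd c ` fst c"
  shows "dual_vector c y \<bullet> w = \<omega> (chart_inv c y) (coord_vector A c w (chart_inv c y))"
proof -
  let ?p = "chart_inv c y"
  have c: "c \<in> charts_at A ?p" using assms by (auto simp: charts_at_def)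
  let ?L = "\<lambda>w. \<omega> ?p (coord_vector A c w ?p)"
  have lin: "?L (s *\<^sub>R v + t *\<^sub>R w) = s * ?L v + t * ?L w" for s t v w
    using form coord_vector_in_tangent_space[OF c]
    unfolding smooth_one_form_def coord_vector_linear[OF c] by blast
  have "linear ?L"
    by (rule linearI) (use lin[of 1 _ 1] lin[of _ _ 0] in auto)
  then have "?L (\<Sum>b\<in>Basis. (w \<bullet> b) *\<^sub>R b) = (\<Sum>b\<in>Basis. (w \<bullet> b) * ?L b)"
    by (simp add: linear_sum[of ?L] linear_scale[of ?L])
  then have "?L w = (\<Sum>b\<in>Basis. (w \<bullet> b) * ?L b)" by (simp only: euclidean_representation)
  then show ?thesis
    by (simp add: dual_vector_def inner_sum_left inner_commute[of w] mult.commute)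
qed

lemma smooth_dual_vector:
  assumes "c \<in> A"
  shows "smooth_on (dual_vector c) (snd c ` fst c)"
  unfolding smooth_on_def
proof
  fix n
  have "cont_diff_on n (\<lambda>y. \<omega> (chart_inv c y) (coord_vector A c b (chart_inv c y))) (snd c ` fst c)" for b
    using form assms unfolding smooth_one_form_def smooth_on_def by blast
  then show "cont_diff_on n (dual_vector c) (snd c ` fst c)"
    unfolding dual_vector_def
    by (intro cont_diff_on_sum open_chart_image[OF assms]
        cont_diff_on_bounded_linear[OF open_chart_image[OF assms] bounded_linear_scaleR_left])
qed

lemma continuous_on_dual_vector: "c \<in> A \<Longrightarrow> continuous_on (snd c ` fst c) (dual_vector c)"
  using smooth_dual_vector unfolding smooth_on_def by (metis cont_diff_on.simps(1))

lemma dual_vector_nonzero: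
  assumes "c \<in> A" "y \<in> snd c ` fst c"
  shows "dual_vector c y \<noteq> 0"
proof -
  let ?p = "chart_inv c y"
  have c: "c \<in> charts_at A ?p" using assms by (auto simp: charts_at_def)
  obtain v where v: "v \<in> tangent_space A ?p" "\<omega> ?p v \<noteq> 0"
    using nonvanishing unfolding nowhere_vanishing_def by blast
  have "\<omega> ?p (coord_vector A c (v c) ?p) = \<omega> ?p v"
    using tangent_vector_eq_coord_vector[OF v(1) c] by metis
  then have "dual_vector c y \<bullet> v c \<noteq> 0" using inner_dual_vector[OF assms] v(2) by metis
  then show ?thesis by auto
qed

text \<open>The segment from \<open>y\<close> to \<open>z\<close> is an admissible curve in the chart \<open>c\<close>.\<close>

definition downhill :: "('a, 'e) chart \<Rightarrow> 'e \<Rightarrow> 'e \<Rightarrow> bool" where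
  "downhill c y z \<longleftrightarrow> closed_segment y z \<subseteq> snd c ` fst c \<and>
     (\<forall>\<xi>\<in>closed_segment y z. dual_vector c \<xi> \<bullet> (z - y) < 0)"

text \<open>In the chart the velocity is constantly \<open>z - y\<close>, on which
  \<open>\<omega>\<close> is negative along the segment. The starting time \<open>a\<close> is free
  so that the segment can continue a curve ending at that time.\<close>

lemma downhill_admissible:
  assumes c: "c \<in> A" and yz: "downhill c y z"
  shows "admissible A \<omega> a (a + 1) (\<lambda>t. chart_inv c (y + (t - a) *\<^sub>R (z - y)))"
proof -
  let ?u = "\<lambda>t. y + (t - a) *\<^sub>R (z - y)"
  have seg: "?u t \<in> closed_segment y z" if "t \<in> {a..a + 1}" for t
    unfolding in_segment using that by (intro exI[of _ "t - a"]) (auto simp: algebra_simps)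
  then have u: "?u t \<in> snd c ` fst c" if "t \<in> {a..a + 1}" for t
    using that yz unfolding downhill_def by blast
  have "\<exists>v. has_velocity A (\<lambda>t. chart_inv c (?u t)) v t {a..a + 1} \<and>
      (chart_inv c (?u t), v) \<in> open_half_bundle A \<omega>" if t: "t \<in> {a..a + 1}" for t
  proof (intro exI conjI)
    let ?v = "coord_vector A c (z - y) (chart_inv c (?u t))"
    have "(?u has_vector_derivative z - y) (at t within {a..a + 1})"
      by (auto intro!: derivative_eq_intros)
    then show vel: "has_velocity A (\<lambda>t. chart_inv c (?u t)) ?v t {a..a + 1}"
      by (rule coordinate_curve_has_velocity[of c ?u t, OF c u[OF t]])
    have "\<omega> (chart_inv c (?u t)) ?v < 0"
      using inner_dual_vector[OF c u[OF t]] seg[OF t] yz unfolding downhill_def by metis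
    then show "(chart_inv c (?u t), ?v) \<in> open_half_bundle A \<omega>"
      using vel by (simp add: has_velocity_def open_half_bundle_def tangent_bundle_def)
  qed
  then show ?thesis
    unfolding admissible_def using abs_continuous_curve_segment[of c a "a + 1" y "z - y", OF c u] by (simp add: AE_I2)
qed

text \<open>The segment prolongs an admissible curve ending at \<open>y\<close>. The case
  \<open>y = x\<close> is listed separately because \<open>x\<close> need not be reachable from
  itself; there the segment alone is the curve.\<close>

lemma downhill_in_I_plus:
  assumes c: "c \<in> A" and y: "y \<in> fst c" "y = x \<or> y \<in> I_plus A \<omega> x" and yz: "downhill c (snd c y) z"
  shows "chart_inv c z \<in> I_plus A \<omega> x"
proof -
  let ?\<sigma> = "\<lambda>a t. chart_inv c (snd c y + (t - a) *\<^sub>R (z - snd c y))"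
  note \<sigma> = downhill_admissible[OF c yz]
  have end\<sigma>: "?\<sigma> a a = y" "?\<sigma> a (a + 1) = chart_inv c z" for a using c y by auto
  from y(2) show ?thesis
  proof
    assume "y = x"
    then show ?thesis unfolding I_plus_def mem_Collect_eq using \<sigma>[of 0] end\<sigma>[of 0]
      by (intro exI[of _ 0] exI[of _ "0 + 1"] exI[of _ "?\<sigma> 0"]) auto
  next
    assume "y \<in> I_plus A \<omega> x"
    then obtain a b \<gamma> where \<gamma>: "a < b" "admissible A \<omega> a b \<gamma>" "\<gamma> a = x" "\<gamma> b = y"
      unfolding I_plus_def by blast
    have "admissible A \<omega> a (b + 1) (\<lambda>t. if t \<le> b then \<gamma> t else ?\<sigma> b t)"
      using \<gamma> end\<sigma>[of b] by (intro admissible_join[OF _ \<sigma>]) auto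
    then show ?thesis unfolding I_plus_def mem_Collect_eq using \<gamma> end\<sigma>[of b]
      by (intro exI[of _ a] exI[of _ "b + 1"] exI[of _ "\<lambda>t. if t \<le> b then \<gamma> t else ?\<sigma> b t"]) auto
  qed
qed

text \<open>Being descending is an open condition on pairs of a point and a direction, and the pairs
  occurring along a segment form a compact set, which leaves a uniform margin
  \<open>e\<close>.\<close>

lemma downhill_open:
  assumes c: "c \<in> A" and yz: "downhill c y z"
  obtains r where "r > 0" "\<And>y' z'. y' \<in> ball y r \<Longrightarrow> z' \<in> ball z r \<Longrightarrow> downhill c y' z'"
proof -
  let ?W = "snd c ` fst c"
  let ?Q = "{q \<in> ?W \<times> UNIV. dual_vector c (fst q) \<bullet> snd q < 0}"
  have W: "open ?W" by (rule open_chart_image[OF c])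
  have "continuous_on (?W \<times> UNIV) (\<lambda>q. dual_vector c (fst q) \<bullet> snd q)"
    by (intro continuous_intros continuous_on_compose2[OF continuous_on_dual_vector[OF c]]) auto
  then have "open ((?W \<times> UNIV) \<inter> (\<lambda>q. dual_vector c (fst q) \<bullet> snd q) -` {..<0})"
    by (rule continuous_open_preimage) (auto intro: open_Times W)
  then have Q: "open ?Q" by (simp add: vimage_def Int_def conj_assoc)
  have K: "compact (closed_segment y z \<times> {z - y})" by (intro compact_Times) auto
  have "closed_segment y z \<times> {z - y} \<subseteq> ?Q"
    using yz unfolding downhill_def by auto
  then obtain e where e: "e > 0" "(\<Union>q\<in>closed_segment y z \<times> {z - y}. cball q e) \<subseteq> ?Q"
    by (rule compact_subset_open_imp_cball_epsilon_subset[OF K Q])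
  \<comment> \<open>Moving both end points by less than \<open>r\<close> moves the points of the
    segment by at most \<open>r\<close> and its direction by at most \<open>2 * r\<close>, together
    at most \<open>e\<close>.\<close>
  define r where "r = e / 3"
  have "downhill c y' z'" if y': "y' \<in> ball y r" and z': "z' \<in> ball z r" for y' z'
  proof -
    have "(\<xi>, z' - y') \<in> ?Q" if \<xi>: "\<xi> \<in> closed_segment y' z'" for \<xi>
    proof -
      obtain t where t: "0 \<le> t" "t \<le> 1" "\<xi> = (1 - t) *\<^sub>R y' + t *\<^sub>R z'"
        using \<xi> by (auto simp: in_segment)
      define \<zeta> where "\<zeta> = (1 - t) *\<^sub>R y + t *\<^sub>R z"
      have \<zeta>: "\<zeta> \<in> closed_segment y z" using t by (auto simp: in_segment \<zeta>_def)
      have n: "norm (y - y') < r" "norm (z - z') < r" using y' z' by (auto simp: dist_norm)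
      have "norm (\<zeta> - \<xi>) = norm ((1 - t) *\<^sub>R (y - y') + t *\<^sub>R (z - z'))"
        by (simp add: t \<zeta>_def algebra_simps)
      also have "\<dots> \<le> (1 - t) * norm (y - y') + t * norm (z - z')"
        using t by (intro norm_triangle_le) simp
      also have "\<dots> \<le> (1 - t) * r + t * r"
        using t n by (intro add_mono mult_left_mono) auto
      finally have 1: "norm (\<zeta> - \<xi>) \<le> r" by (simp add: algebra_simps)
      have "norm ((z - y) - (z' - y')) = norm ((z - z') - (y - y'))" by (simp add: algebra_simps)
      also have "\<dots> \<le> 2 * r" using n norm_triangle_ineq4[of "z - z'" "y - y'"] by linarith
      finally have 2: "norm ((z - y) - (z' - y')) \<le> 2 * r" .
      have "dist (\<zeta>, z - y) (\<xi>, z' - y') \<le> e"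
        using norm_Pair_le[of "\<zeta> - \<xi>" "(z - y) - (z' - y')"] 1 2 by (simp add: dist_norm r_def)
      then show ?thesis using e(2) \<zeta> by (auto simp: subset_iff)
    qed
    then show ?thesis unfolding downhill_def by auto
  qed
  then show thesis using that[of r] e(1) by (simp add: r_def)
qed

text \<open>A point of the closure is approximated by a reachable \<open>y'\<close>, from which
  segments still descend to all points of a whole ball around \<open>z\<close>. The chart carries
  that ball to an open set of reachable points.\<close>

lemma closure_downhill_interior:
  assumes c: "c \<in> A" and y: "y \<in> fst c" "y \<in> closure (I_plus A \<omega> x)" and yz: "downhill c (snd c y) z"
  shows "chart_inv c z \<in> interior (I_plus A \<omega> x)"
proof -
  obtain r where r: "r > 0"
    "\<And>y' z'. y' \<in> ball (snd c y) r \<Longrightarrow> z' \<in> ball z r \<Longrightarrow> downhill c y' z'"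
    using downhill_open[OF c yz] by blast
  have "open (fst c \<inter> snd c -` ball (snd c y) r)" using open_chart_preimage[OF c] by blast
  moreover have "y \<in> fst c \<inter> snd c -` ball (snd c y) r" using y(1) r(1) by simp
  ultimately obtain y' where y': "y' \<in> I_plus A \<omega> x" "y' \<in> fst c" "snd c y' \<in> ball (snd c y) r"
    using y(2) unfolding closure_iff_nhds_not_empty by blast
  have "chart_inv c z' \<in> I_plus A \<omega> x" "z' \<in> snd c ` fst c" if "z' \<in> ball z r" for z'
    using r(2)[OF y'(3) that] downhill_in_I_plus[OF c y'(2)] y'(1) unfolding downhill_def by auto
  then have "chart_inv c ` ball z r \<subseteq> I_plus A \<omega> x" "open (chart_inv c ` ball z r)"
    by (auto intro!: open_chart_inv_image[OF c])
  then show ?thesis using r(1) by (intro interiorI[of "chart_inv c ` ball z r"]) auto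
qed

text \<open>Minus the dual vector at \<open>y\<close> is a descending direction at \<open>y\<close>
  and, by continuity, at nearby points; one short segment along it starts at \<open>y\<close> and
  another ends there.\<close>

lemma exists_downhill:
  assumes c: "c \<in> A" and y: "y \<in> snd c ` fst c"
  obtains z z' where "downhill c y z" "downhill c z' y"
proof -
  let ?W = "snd c ` fst c" and ?g = "dual_vector c y"
  have "open (?W \<inter> (\<lambda>\<xi>. dual_vector c \<xi> \<bullet> ?g) -` {0<..})"
    by (intro continuous_open_preimage continuous_intros continuous_on_dual_vector c open_chart_image)
  moreover have "y \<in> ?W \<inter> (\<lambda>\<xi>. dual_vector c \<xi> \<bullet> ?g) -` {0<..}"
    using dual_vector_nonzero[OF c y] y by simp
  ultimately obtain e where e: "e > 0" "cball y e \<subseteq> ?W \<inter> (\<lambda>\<xi>. dual_vector c \<xi> \<bullet> ?g) -` {0<..}"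
    using open_contains_cball by meson
  \<comment> \<open>Chosen so that \<open>s *\<^sub>R ?g\<close> has length \<open>e\<close>, which
    keeps both end points in \<open>cball y e\<close>.\<close>
  define s where "s = e / norm ?g"
  have s: "s > 0" using e dual_vector_nonzero[OF c y] by (simp add: s_def)
  have down: "downhill c p q"
    if "p \<in> cball y e" "q \<in> cball y e" "q - p = - (s *\<^sub>R ?g)" for p q
  proof -
    have "closed_segment p q \<subseteq> cball y e" using that by (simp add: closed_segment_subset)
    then have "\<xi> \<in> ?W" "dual_vector c \<xi> \<bullet> ?g > 0" if "\<xi> \<in> closed_segment p q" for \<xi>
      using e(2) that by (blast, auto)
    then show ?thesis using s that by (auto simp: downhill_def)
  qed
  have "y - s *\<^sub>R ?g \<in> cball y e" "y + s *\<^sub>R ?g \<in> cball y e" "y \<in> cball y e"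
    using e(1) dual_vector_nonzero[OF c y] by (auto simp: dist_norm s_def)
  then show thesis
    by (intro that[of "y - s *\<^sub>R ?g" "y + s *\<^sub>R ?g"] down) auto
qed

text \<open>Two segments are joined: the first leads from \<open>x\<close> to a reachable point, and
  the second leads from there into the interior.\<close>

lemma interior_I_plus_nonempty: "interior (I_plus A \<omega> x) \<noteq> {}"
proof -
  obtain c where c: "c \<in> A" "x \<in> fst c" using exists_chart_at by blast
  obtain z where z: "downhill c (snd c x) z" using exists_downhill[OF c(1)] c(2) by blast
  define y where "y = chart_inv c z"
  have zW: "z \<in> snd c ` fst c" using z unfolding downhill_def by auto
  have y: "y \<in> I_plus A \<omega> x" unfolding y_def using downhill_in_I_plus[OF c _ z] by blast
  have yc: "y \<in> fst c" unfolding y_def using chart_inv_in_domain[OF c(1) zW] .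
  obtain z' where "downhill c (snd c y) z'" using exists_downhill[OF c(1)] yc by blast
  then show ?thesis using closure_downhill_interior[OF c(1) yc] y closure_subset by blast
qed

text \<open>A descending segment that ends at a boundary point cannot start in the closure, since
  its end would then be interior.\<close>

lemma complement_closure_I_plus_nonempty:
  assumes p: "p \<in> frontier (I_plus A \<omega> x)"
  shows "- closure (I_plus A \<omega> x) \<noteq> {}"
proof -
  obtain c where c: "c \<in> A" "p \<in> fst c" using exists_chart_at by blast
  obtain z where z: "downhill c z (snd c p)" using exists_downhill[OF c(1)] c(2) by blast
  then have zW: "z \<in> snd c ` fst c" unfolding downhill_def by auto
  have "chart_inv c z \<notin> closure (I_plus A \<omega> x)"
  proof
    assume "chart_inv c z \<in> closure (I_plus A \<omega> x)"
    then have "chart_inv c (snd c p) \<in> interior (I_plus A \<omega> x)"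
      using closure_downhill_interior[OF c(1) chart_inv_in_domain[OF c(1) zW], of x "snd c p"] z zW c
      by simp
    then show False using p c by (simp add: frontier_def)
  qed
  then show ?thesis by blast
qed

text \<open>The chart images of the closure and the interior satisfy the assumptions of
  \<open>boundary_is_smooth_graph\<close>. A shear along \<open>b\<close> that subtracts the graph
  function then straightens the boundary.\<close>

lemma frontier_slice_chart:
  assumes p: "p \<in> frontier (I_plus A \<omega> x)"
  shows "\<exists>c\<in>charts_at A p. \<exists>b\<in>Basis. \<exists>r.
    snd c ` (frontier (I_plus A \<omega> x) \<inter> fst c) = {y \<in> snd c ` fst c. y \<bullet> b = r}"
proof -
  let ?I = "I_plus A \<omega> x"
  obtain c where c: "c \<in> A" "p \<in> fst c" using exists_chart_at by blast
  let ?W = "snd c ` fst c"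
  let ?E = "snd c ` (fst c \<inter> closure ?I)" and ?N = "snd c ` (fst c \<inter> interior ?I)"
  have inj: "inj_on (snd c) (fst c)"
    using c(1) by (intro inj_on_inverseI[of _ "chart_inv c"]) simp
  have mem: "snd c q \<in> snd c ` (fst c \<inter> X) \<longleftrightarrow> q \<in> X" if "q \<in> fst c" for q X
    using inj that by (auto simp: inj_on_def)
  have mem_frontier: "snd c q \<in> ?E - ?N \<longleftrightarrow> q \<in> frontier ?I" if "q \<in> fst c" for q
    using mem[OF that] by (auto simp: frontier_def)
  have "?W - ?E = snd c ` (fst c \<inter> - closure ?I)" using mem by blast
  then have "open (?W - ?E)" using open_chart_image_Int[OF c(1), of "- closure ?I"] by (simp add: open_Compl)
  moreover have "open ?N" by (intro open_chart_image_Int c(1)) simp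
  moreover have "?N \<subseteq> ?E" using interior_subset closure_subset by blast
  moreover have "snd c p \<in> ?E - ?N" using mem_frontier c p by blast
  moreover have "dual_vector c (snd c p) \<noteq> 0" using dual_vector_nonzero c by blast
  moreover have "z \<in> ?N" if yz: "y \<in> ?E" "closed_segment y z \<subseteq> ?W"
    "\<And>\<xi>. \<xi> \<in> closed_segment y z \<Longrightarrow> dual_vector c \<xi> \<bullet> (z - y) < 0" for y z
  proof -
    obtain q where q: "q \<in> fst c" "q \<in> closure ?I" "y = snd c q" using yz(1) by blast
    have "downhill c (snd c q) z" using that q by (simp add: downhill_def)
    then have "chart_inv c z \<in> interior ?I" by (rule closure_downhill_interior[OF c(1) q(1,2)])
    moreover have "z \<in> ?W" using that(2) by auto
    ultimately show ?thesis
      using c(1) by (intro image_eqI[of _ _ "chart_inv c z"]) (auto intro: chart_inv_in_domain)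
  qed
  ultimately obtain b V Y f where b: "b \<in> Basis" and V: "open V" "snd c p \<in> V" "V \<subseteq> ?W"
    and Y: "open Y" "V \<subseteq> Y" "smooth_on f Y"
    and shift: "\<And>y s. y + s *\<^sub>R b \<in> Y \<longleftrightarrow> y \<in> Y" "\<And>y s. f (y + s *\<^sub>R b) = f y"
    and graph: "\<And>y. y \<in> V \<Longrightarrow> y \<in> ?E - ?N \<longleftrightarrow> y \<bullet> b = f y"
    using boundary_is_smooth_graph[OF open_chart_image[OF c(1)], of ?N ?E "dual_vector c" "snd c p"]
      smooth_dual_vector[OF c(1)] by (metis (no_types, lifting) image_mono Int_lower1)
  \<comment> \<open>The shear along \<open>b\<close> and its inverse: they undo each other because
    \<open>f\<close> does not change along \<open>b\<close>.\<close>
  define \<Phi> where "\<Phi> = (\<lambda>y. y + (- f y) *\<^sub>R b)"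
  define \<Psi> where "\<Psi> = (\<lambda>y. y + f y *\<^sub>R b)"
  have \<Phi>\<Psi>: "\<Psi> (\<Phi> y) = y" "\<Phi> (\<Psi> y) = y" for y
    unfolding \<Phi>_def \<Psi>_def shift by simp_all
  have sm: "smooth_on (\<lambda>y. y + k *\<^sub>R (f y *\<^sub>R b)) Y" for k
    unfolding smooth_on_def
  proof
    fix n
    have "cont_diff_on n f Y" using Y(3) by (simp add: smooth_on_def)
    then have "cont_diff_on n (\<lambda>y. k *\<^sub>R (f y *\<^sub>R b)) Y"
      by (intro cont_diff_on_bounded_linear[OF Y(1), of "\<lambda>s. k *\<^sub>R (s *\<^sub>R b)"] bounded_linear_intros)
    then show "cont_diff_on n (\<lambda>y. y + k *\<^sub>R (f y *\<^sub>R b)) Y"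
      by (intro cont_diff_on_add cont_diff_on_id Y(1))
  qed
  have \<Phi>Y: "smooth_on \<Phi> Y" and \<Psi>Y: "smooth_on \<Psi> Y"
    using sm[of "-1"] sm[of 1] by (simp_all add: \<Phi>_def \<Psi>_def)
  \<comment> \<open>As a preimage under the continuous \<open>\<Psi>\<close>, the image of
    \<open>V\<close> is seen to be open without an inverse function theorem.\<close>
  have \<Phi>V: "\<Phi> ` V = Y \<inter> \<Psi> -` V"
  proof
    have "\<Phi> y \<in> Y \<longleftrightarrow> y \<in> Y" for y unfolding \<Phi>_def by (rule shift(1))
    then show "\<Phi> ` V \<subseteq> Y \<inter> \<Psi> -` V" using \<Phi>\<Psi>(1) Y(2) by auto
    show "Y \<inter> \<Psi> -` V \<subseteq> \<Phi> ` V" using \<Phi>\<Psi>(2) by (metis IntD2 image_eqI subsetI vimageD)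
  qed
  have "continuous_on Y \<Psi>" using \<Psi>Y unfolding smooth_on_def by (metis cont_diff_on.simps(1))
  then have "open (\<Phi> ` V)" unfolding \<Phi>V using Y(1) V(1) by (rule continuous_open_preimage)
  moreover have "smooth_on \<Psi> (\<Phi> ` V)" using smooth_on_subset[OF \<Psi>Y] \<Phi>V by blast
  ultimately have chart': "(fst c \<inter> snd c -` V, \<Phi> \<circ> snd c) \<in> A" (is "?c \<in> A")
    using diffeomorphism_comp_chart_in_structure[OF c(1) V(1,3) _ smooth_on_subset[OF \<Phi>Y Y(2)]] \<Phi>\<Psi>(1)
    by blast
  \<comment> \<open>As \<open>b\<close> is a unit vector, the height of \<open>\<Phi> y\<close> is
    \<open>y \<bullet> b - f y\<close>, so the graph becomes the slice at height zero.\<close>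
  have "q \<in> frontier ?I \<longleftrightarrow> \<Phi> (snd c q) \<bullet> b = 0" if "q \<in> fst c \<inter> snd c -` V" for q
    using mem_frontier[of q] graph[of "snd c q"] that b
    by (auto simp: \<Phi>_def inner_diff_left inner_same_Basis)
  then have "snd ?c ` (frontier ?I \<inter> fst ?c) = {y \<in> snd ?c ` fst ?c. y \<bullet> b = 0}"
    by auto
  moreover have "?c \<in> charts_at A p" using chart' c(2) V(2) by (simp add: charts_at_def)
  ultimately show ?thesis using b by blast
qed

end

text \<open>A set with empty frontier is both open and closed.\<close>

lemma connected_frontier_nonempty:
  assumes "connected (UNIV :: 'a::topological_space set)" "S \<noteq> {}" "S \<noteq> (UNIV :: 'a set)"
  shows "frontier S \<noteq> {}"
proof
  assume "frontier S = {}"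
  then have "open S" "closed S"
    using interior_subset[of S] closure_subset[of S]
    by (auto simp: frontier_def interior_eq[symmetric] closure_eq[symmetric] simp del: interior_eq closure_eq)
  then show False using assms connectedD[of UNIV S "- S"] by auto
qed

theorem theoremA1:
  fixes A :: "('a::{t2_space,second_countable_topology}, 'e::euclidean_space) chart set"
    and \<omega> :: "'a \<Rightarrow> ('a, 'e) tangent_vector \<Rightarrow> real"
    and x :: 'a
  assumes "smooth_structure A"
    and "DIM('e) \<ge> 2"
    and "connected (UNIV :: 'a set)"
    and "smooth_one_form A \<omega>"
    and "nowhere_vanishing A \<omega>"
    and "I_plus A \<omega> x \<noteq> UNIV"
  shows "frontier (I_plus A \<omega> x) \<noteq> {} \<and>
         smooth_hypersurface A (frontier (I_plus A \<omega> x)) \<and>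
         separates_space (frontier (I_plus A \<omega> x))"
proof -
  interpret nonvanishing_one_form A \<omega>
    using assms by unfold_locales
  let ?I = "I_plus A \<omega> x"
  have int: "interior ?I \<noteq> {}" by (rule interior_I_plus_nonempty)
  then have "?I \<noteq> {}" by auto
  then have front: "frontier ?I \<noteq> {}"
    using connected_frontier_nonempty assms(3,6) by blast
  then have compl: "- closure ?I \<noteq> {}" using complement_closure_I_plus_nonempty by blast
  have "interior ?I \<subseteq> closure ?I" using interior_subset closure_subset by blast
  \<comment> \<open>The interior and the complement of the closure are disjoint, open and nonempty,
    and together they make up the complement of the frontier.\<close>
  then have "\<not> connected (UNIV - frontier ?I)"
    unfolding connected_def not_not using int compl
    by (intro exI[of _ "interior ?I"] exI[of _ "- closure ?I"]) (auto simp: frontier_def)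
  then show ?thesis
    using front frontier_slice_chart unfolding smooth_hypersurface_def separates_space_def by blast
qed

end
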